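(* For all integers $m,p\ge 1$ and $l\ge 0$, $$(-1)^m \sum_{j=1}^p \alpha_{p-j}\, W_l(2j+2m+l-1,\,2m+l)=(-1)^p \sum_{j=1}^m \alpha_{m-j}\, W_l(2j+2p+l-1,\,2p+l),$$ where $\alpha_n=(-1)^n \pi^{2n}/(2n+1)!$ for $n\ge 0$.
   Context: For positive integers $k_1,\dots,k_r$ and signs $\sigma_1,\dots,\sigma_r\in\{\pm1\}$ with $(k_r,\sigma_r)\ne(1,1)$, define $$T(k_1,\dots,k_r;\sigma_1,\dots,\sigma_r):=2^r\sum_{0<n_1<\cdots<n_r}\frac{\sigma_1^{n_1}\sigma_2^{n_2}\cdots\sigma_r^{n_r}}{(2n_1-1)^{k_1}(2n_2-2)^{k_2}\cdots(2n_r-r)^{k_r}}$$ (conditionally convergent sums are limits as $N\to\infty$ of the sums over $n_r\le N$). The signs are indicated by placing a bar over $k_j$ exactly when $\sigma_j=-1$; e.g. $T(\bar2,3,\bar1)=T(2,3,1;-1,1,-1)$. For integers $0\le l\le r$, $r\ge1$, define $$W_l(k,r):=\sum_{\substack{k_1+\cdots+k_r=k\\ k_1,\dots,k_r\ge1}}T(k_1,\dots,k_{l-1},\overline{k_l},k_{l+1},\dots,k_{r-1},\overline{k_r}),$$ with bars at positions $l$ and $r$ if $1\le l<r$; if $l=0$ or $l=r$, only the last entry is barred, i.e. $W_0(k,r)=W_r(k,r)=\sum T(k_1,\dots,k_{r-1},\overline{k_r})$. *)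

theory Defs
  imports "HOL-Analysis.Analysis"
begin

text \<open>
  Indices and exponents of length \<open>r\<close> are extensional functions on \<open>{1..r}\<close>, so that positions
  are numbered from \<open>1\<close>.
\<close>

definition T_partial :: "nat \<Rightarrow> (nat \<Rightarrow> nat) \<Rightarrow> (nat \<Rightarrow> int) \<Rightarrow> nat \<Rightarrow> real" where
  "T_partial r k \<sigma> N =
     2 ^ r * (\<Sum>n \<in> {n \<in> {1..r} \<rightarrow>\<^sub>E {1..N}. strict_mono_on {1..r} n}.
       \<Prod>j = 1..r. of_int (\<sigma> j) ^ n j / (2 * real (n j) - real j) ^ k j)"

text \<open>
  For \<open>r \<ge> 1\<close>, the truncation \<open>n j \<le> N\<close> for all \<open>j\<close> amounts to \<open>n r \<le> N\<close> by monotonicity.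
  The value is meant for signs in \<open>{-1, 1}\<close>, positive exponents and \<open>(k r, \<sigma> r) \<noteq> (1, 1)\<close>.
\<close>

definition T :: "nat \<Rightarrow> (nat \<Rightarrow> nat) \<Rightarrow> (nat \<Rightarrow> int) \<Rightarrow> real" where
  "T r k \<sigma> = lim (T_partial r k \<sigma>)"

definition compositions :: "nat \<Rightarrow> nat \<Rightarrow> (nat \<Rightarrow> nat) set" where
  "compositions w r = {k \<in> {1..r} \<rightarrow>\<^sub>E {1..}. (\<Sum>j = 1..r. k j) = w}"

lemma finite_compositions: "finite (compositions w r)"
proof (rule finite_subset)
  show "compositions w r \<subseteq> {1..r} \<rightarrow>\<^sub>E {..w}"
  proof
    fix k assume k: "k \<in> compositions w r"
    then have "k j \<le> w" if "j \<in> {1..r}" for j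
      using that member_le_sum[of j "{1..r}" k] by (auto simp: compositions_def)
    with k show "k \<in> {1..r} \<rightarrow>\<^sub>E {..w}"
      by (auto simp: compositions_def PiE_iff)
  qed
qed (auto intro: finite_PiE)

text \<open>
  Entry \<open>r\<close> is always barred, and entry \<open>l\<close> is barred if \<open>1 \<le> l < r\<close>; since positions start at
  \<open>1\<close>, the cases \<open>l = 0\<close> and \<open>l = r\<close> leave only the last entry barred.
\<close>

definition bar_signs :: "nat \<Rightarrow> nat \<Rightarrow> nat \<Rightarrow> int" where
  "bar_signs l r j = (if j = l \<or> j = r then - 1 else 1)"

definition W :: "nat \<Rightarrow> nat \<Rightarrow> nat \<Rightarrow> real" where
  "W l w r = (\<Sum>k \<in> compositions w r. T r k (bar_signs l r))"

definition \<alpha> :: "nat \<Rightarrow> real" where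
  "\<alpha> n = (- 1) ^ n * pi ^ (2 * n) / fact (2 * n + 1)"

end

theory Submission
  imports Defs
begin

text \<open>
  Fix \<open>l\<close> and substitute \<open>t = (1 - u) / (1 + u)\<close>, \<open>L = - ln u\<close>. Summing over all compositions of a
  given weight turns the nested sums of depth \<open>l + M\<close> into a single iterated integral along
  \<open>0 < t < 1\<close>: starting from \<open>L\<^sup>q / q!\<close> one integrates \<open>l\<close> times against
  \<open>dt / t\<close> and \<open>M\<close> times against \<open>2 dt / (1 + t\<^sup>2) = d (2 arctan t)\<close>. The kernel
  changes after \<open>l\<close> steps because of the bars at positions \<open>l\<close> and \<open>l + M\<close>. Integrating the last
  \<open>M\<close> steps by parts gives, for even \<open>M\<close>,

    \<open>W l (q + l + M) (l + M) = \<integral> K(t) d ((2 arctan t)\<^sup>M / M!)\<close>,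

  where \<open>K\<close> is the result of the first \<open>l\<close> steps (\<open>W_integral\<close>).

  Expand \<open>(2 arctan t)\<^sup>M / M! = \<Sum>n. b\<^sub>M\<^sub>,\<^sub>n t\<^sup>n\<close>. Since \<open>\<integral> t\<^bsup>n-1\<^esup> K dt\<close> is
  \<open>n\<^bsup>-l\<^esup>\<close> times the logarithmic moment \<open>X\<^sub>q(n) = \<integral> t\<^bsup>n-1\<^esup> L\<^sup>q / q! dt\<close> (\<open>chain_moment\<close>), the
  sum is formally \<open>\<Sum>n. n\<^bsup>1-l\<^esup> b\<^sub>M\<^sub>,\<^sub>n X\<^sub>q(n)\<close>. The point is that the \<open>\<alpha>\<close>-convolution of the
  moments is again an arctangent coefficient: for even \<open>n\<close>

    \<open>2 \<Sum>j. \<alpha> (p - j) X\<^bsub>2j-1\<^esub>(n) = (- 1)\<^bsup>n/2+p\<^esup> b\<^bsub>2p,n\<^esub>\<close>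

  (\<open>even_odd_convolutions\<close>). Both sides satisfy the same three-term recurrence in \<open>n\<close>, and the
  initial value is \<open>\<integral> ((1 + t) / (1 - t))\<^sup>y dt\<close> over \<open>{-1..1}\<close>, a Beta integral equal to
  \<open>2 \<pi> y / sin (\<pi> y)\<close>, while \<open>\<alpha>\<close> has the generating function \<open>sin (\<pi> y) / (\<pi> y)\<close>.
  Hence, with \<open>M = 2m\<close>, the left side of the theorem is formally the sum over even \<open>n\<close> of
  \<open>(- 1)\<^bsup>n/2+m+p\<^esup> n\<^bsup>1-l\<^esup> b\<^bsub>2m,n\<^esub> b\<^bsub>2p,n\<^esub> / 2\<close>, which is symmetric in \<open>m\<close> and \<open>p\<close>.

  For \<open>l = 0\<close> this last series does not converge absolutely, and the termwise integration is not
  justified as it stands. So \<open>arctan t\<close> is replaced by \<open>arctan (s t)\<close> with \<open>s < 1\<close>, which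
  multiplies the \<open>n\<close>-th term by \<open>s\<^sup>n\<close>; the symmetric identity is proved there and carried to
  \<open>s = 1\<close> by dominated convergence.
\<close>

section \<open>Power series at the boundary of the disc, and integrals from boundary limits\<close>

lemma summable_bounded_powser:
  fixes c :: "nat \<Rightarrow> real"
  assumes c: "\<And>n. \<bar>c n\<bar> \<le> C" and z: "\<bar>z\<bar> < 1"
  shows "summable (\<lambda>n. c n * z ^ n)"
proof (rule summable_comparison_test')
  show "summable (\<lambda>n. C * \<bar>z\<bar> ^ n)"
    using z by (intro summable_mult summable_geometric) auto
  show "norm (c n * z ^ n) \<le> C * \<bar>z\<bar> ^ n" if "n \<ge> 0" for n
    using c[of n] by (auto simp: abs_mult power_abs intro!: mult_right_mono)
qed

text \<open>
  This serves two purposes: applied to partial sums it gives Abel's theorem below, and applied to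
  the coefficients of a sum of the theorem it bounds the growth of their generating function, which
  makes every boundary term at \<open>t = 0\<close> vanish without any knowledge of its logarithmic singularity.
\<close>

lemma powser_null_coeffs_at_1:
  fixes c :: "nat \<Rightarrow> real"
  assumes c: "c \<longlonglongrightarrow> 0"
  shows "((\<lambda>z. (1 - z) * (\<Sum>n. c n * z ^ n)) \<longlongrightarrow> 0) (at_left 1)"
proof -
  obtain C where C: "\<And>n. \<bar>c n\<bar> \<le> C"
    using convergent_imp_Bseq[of c] c by (auto simp: convergent_def Bseq_def)
  show ?thesis
  proof (rule tendstoI)
    fix e :: real assume e: "e > 0"
    obtain N where N: "\<And>n. n \<ge> N \<Longrightarrow> \<bar>c n\<bar> < e / 2"
      using LIMSEQ_D[OF c, of "e / 2"] e by auto
    define A where "A = (\<Sum>n<N. \<bar>c n\<bar>)"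
    have A: "A \<ge> 0" by (auto simp: A_def intro: sum_nonneg)
    have bound: "\<bar>(1 - z) * (\<Sum>n. c n * z ^ n)\<bar> \<le> (1 - z) * A + e / 2" if z: "0 < z" "z < 1" for z
    proof -
      have s: "summable (\<lambda>n. c n * z ^ n)"
        using summable_bounded_powser[OF C, of z] z by auto
      have s': "summable (\<lambda>n. c (n + N) * z ^ (n + N))"
        using s by (rule summable_ignore_initial_segment)
      have g: "summable (\<lambda>n. e / 2 * z ^ n)"
        using z by (intro summable_mult summable_geometric) auto
      have "(\<Sum>n. c n * z ^ n) = (\<Sum>n. c (n + N) * z ^ (n + N)) + (\<Sum>n<N. c n * z ^ n)"
        by (rule suminf_split_initial_segment[OF s])
      moreover have "\<bar>\<Sum>n<N. c n * z ^ n\<bar> \<le> A"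
        unfolding A_def
        using z by (intro order.trans[OF sum_abs] sum_mono)
          (auto simp: abs_mult power_abs intro!: mult_left_le power_le_one)
      moreover have "\<bar>\<Sum>n. c (n + N) * z ^ (n + N)\<bar> \<le> (\<Sum>n. e / 2 * z ^ n)"
      proof -
        have le: "\<bar>c (n + N) * z ^ (n + N)\<bar> \<le> e / 2 * z ^ n" for n
        proof -
          have "\<bar>c (n + N)\<bar> * (z ^ n * z ^ N) \<le> e / 2 * (z ^ n * 1)"
            using N[of "n + N"] z e
            by (intro mult_mono) (auto intro!: mult_left_le power_le_one)
          then show ?thesis using z by (simp add: abs_mult power_add)
        qed
        have abs: "summable (\<lambda>n. \<bar>c (n + N) * z ^ (n + N)\<bar>)"
          by (rule summable_comparison_test'[OF g, of 0]) (use le in auto)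
        have "\<bar>\<Sum>n. c (n + N) * z ^ (n + N)\<bar> \<le> (\<Sum>n. \<bar>c (n + N) * z ^ (n + N)\<bar>)"
          by (rule summable_rabs[OF abs])
        also have "\<dots> \<le> (\<Sum>n. e / 2 * z ^ n)" by (rule suminf_le[OF le abs g])
        finally show ?thesis .
      qed
      moreover have "(\<Sum>n. e / 2 * z ^ n) = e / 2 / (1 - z)"
        using z by (subst suminf_mult) (auto simp: suminf_geometric summable_geometric)
      ultimately have "\<bar>\<Sum>n. c n * z ^ n\<bar> \<le> A + e / 2 / (1 - z)" by linarith
      then have "(1 - z) * \<bar>\<Sum>n. c n * z ^ n\<bar> \<le> (1 - z) * (A + e / 2 / (1 - z))"
        using z by (intro mult_left_mono) auto
      also have "(1 - z) * (A + e / 2 / (1 - z)) = (1 - z) * A + e / 2"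
        using z by (simp add: field_simps)
      also have "(1 - z) * \<bar>\<Sum>n. c n * z ^ n\<bar> = \<bar>(1 - z) * (\<Sum>n. c n * z ^ n)\<bar>"
        using z by (subst abs_mult) simp
      finally show ?thesis .
    qed
    have "((\<lambda>z::real. (1 - z) * A + e / 2) \<longlongrightarrow> (1 - 1) * A + e / 2) (at_left 1)"
      by (intro tendsto_intros)
    then have "eventually (\<lambda>z::real. (1 - z) * A + e / 2 < e) (at_left 1)"
      by (rule order_tendstoD) (use e in auto)
    moreover have "eventually (\<lambda>z::real. 0 < z \<and> z < 1) (at_left 1)"
      by (rule eventually_at_left_1) auto
    ultimately show "eventually (\<lambda>z. dist ((1 - z) * (\<Sum>n. c n * z ^ n)) 0 < e) (at_left 1)"
      by eventually_elim (use bound in \<open>fastforce simp: dist_real_def\<close>)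
  qed
qed

text \<open>
  Summation by parts: with \<open>d n\<close> the error of the \<open>n\<close>-th partial sum, the difference between the
  power series and its value at \<open>1\<close> is \<open>(1 - z) (\<Sum>n. d n z\<^sup>n)\<close>, and \<open>d\<close> is a null sequence.
\<close>

lemma abel_limit:
  fixes c :: "nat \<Rightarrow> real"
  assumes c: "summable c"
  shows "((\<lambda>z. \<Sum>n. c n * z ^ n) \<longlongrightarrow> suminf c) (at_left 1)"
proof -
  define s where "s = suminf c"
  define d where "d n = (\<Sum>k\<le>n. c k) - s" for n
  have d0: "d \<longlonglongrightarrow> 0"
    using tendsto_diff[OF summable_LIMSEQ'[OF c] tendsto_const[of s]]
    by (simp add: d_def[abs_def] s_def)
  obtain D where D: "\<And>n. \<bar>d n\<bar> \<le> D"
    using convergent_imp_Bseq[of d] d0 by (auto simp: convergent_def Bseq_def)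
  have eq: "(1 - z) * (\<Sum>n. d n * z ^ n) + s = (\<Sum>n. c n * z ^ n)" if z: "0 < z" "z < 1" for z
  proof -
    have sd: "summable (\<lambda>n. d n * z ^ n)" using summable_bounded_powser[OF D, of z] z by auto
    have sd': "summable (\<lambda>n. d (Suc n) * z ^ Suc n)" using sd by (subst summable_Suc_iff)
    have "\<bar>c (Suc n)\<bar> \<le> 2 * D" for n
      using D[of n] D[of "Suc n"] unfolding d_def sum.atMost_Suc by linarith
    moreover have "\<bar>c 0\<bar> \<le> \<bar>c 0\<bar> + 2 * D" "2 * D \<le> \<bar>c 0\<bar> + 2 * D"
      using D[of 0] by linarith+
    ultimately have "\<bar>c n\<bar> \<le> \<bar>c 0\<bar> + 2 * D" for n
      using order.trans by (cases n) blast+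
    then have sc: "summable (\<lambda>n. c n * z ^ n)" using summable_bounded_powser[of c _ z] z by auto
    have "(\<Sum>n. c n * z ^ n) = c 0 + (\<Sum>n. c (Suc n) * z ^ Suc n)"
      using suminf_split_head[OF sc] by simp
    also have "(\<Sum>n. c (Suc n) * z ^ Suc n) = (\<Sum>n. d (Suc n) * z ^ Suc n - z * (d n * z ^ n))"
      by (intro suminf_cong) (auto simp: d_def algebra_simps)
    also have "\<dots> = (\<Sum>n. d (Suc n) * z ^ Suc n) - z * (\<Sum>n. d n * z ^ n)"
      using sd sd' by (subst suminf_diff[symmetric]) (auto intro: summable_mult simp: suminf_mult)
    also have "(\<Sum>n. d (Suc n) * z ^ Suc n) = (\<Sum>n. d n * z ^ n) - d 0"
      using suminf_split_head[OF sd] by simp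
    finally show ?thesis by (simp add: d_def algebra_simps)
  qed
  have "((\<lambda>z. (1 - z) * (\<Sum>n. d n * z ^ n) + s) \<longlongrightarrow> 0 + s) (at_left 1)"
    by (intro tendsto_add powser_null_coeffs_at_1[OF d0] tendsto_const)
  moreover have "eventually (\<lambda>z::real. (1 - z) * (\<Sum>n. d n * z ^ n) + s = (\<Sum>n. c n * z ^ n)) (at_left 1)"
    by (rule eventually_at_left_1) (rule eq)
  ultimately show ?thesis by (simp add: s_def tendsto_cong)
qed

text \<open>
  The integrands below have logarithmic singularities at both ends of \<open>{0..1}\<close>. For the gauge
  integral, limits of the antiderivative are enough; no integrability has to be shown beforehand.
\<close>

lemma has_integral_from_limits:
  fixes f :: "real \<Rightarrow> real"
  assumes ab: "a < b"
    and deriv: "\<And>x. a < x \<Longrightarrow> x < b \<Longrightarrow> (f has_real_derivative f' x) (at x)"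
    and A: "(f \<longlongrightarrow> A) (at_right a)" and B: "(f \<longlongrightarrow> B) (at_left b)"
  shows "(f' has_integral (B - A)) {a..b}"
proof -
  define g where "g x = (if x \<le> a then A else if x \<ge> b then B else f x)" for x
  have near: "eventually (\<lambda>y. y = x \<or> (a < y \<and> y < b)) (at x within {a..b})"
    if "x = a \<or> x = b" for x
    using that ab by (auto simp: eventually_at intro!: exI[of _ "b - a"] simp: dist_real_def)
  have "continuous_on {a..b} g"
    unfolding continuous_on_def
  proof
    fix x assume x: "x \<in> {a..b}"
    consider "x = a" | "x = b" | "a < x" "x < b" using x by fastforce
    then show "(g \<longlongrightarrow> g x) (at x within {a..b})"
    proof cases
      case 1
      have "eventually (\<lambda>y. f y = g y) (at_right a)"
        using ab by (auto simp: eventually_at g_def dist_real_def intro!: exI[of _ "b - a"])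
      with A have "(g \<longlongrightarrow> A) (at_right a)" by (simp add: tendsto_cong)
      with 1 ab show ?thesis by (simp add: at_within_Icc_at_right g_def)
    next
      case 2
      have "eventually (\<lambda>y. f y = g y) (at_left b)"
        using ab by (auto simp: eventually_at g_def dist_real_def intro!: exI[of _ "b - a"])
      with B have "(g \<longlongrightarrow> B) (at_left b)" by (simp add: tendsto_cong)
      with 2 ab show ?thesis by (simp add: at_within_Icc_at_left g_def)
    next
      case 3
      have "eventually (\<lambda>y. y \<in> {a<..<b}) (at x)"
        using 3 by (intro eventually_at_in_open') auto
      then have ev: "eventually (\<lambda>y. f y = g y) (at x)"
        by eventually_elim (auto simp: g_def)
      have "(f \<longlongrightarrow> f x) (at x)" using deriv[OF 3] DERIV_isCont isCont_def by blast
      with ev have "(g \<longlongrightarrow> f x) (at x)" by (simp add: tendsto_cong)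
      then have "(g \<longlongrightarrow> f x) (at x within {a..b})" by (rule tendsto_within_subset) simp
      then show ?thesis using 3 by (simp add: g_def)
    qed
  qed
  moreover have "(g has_vector_derivative f' x) (at x)" if x: "x \<in> {a<..<b}" for x
  proof -
    have "eventually (\<lambda>y. y \<in> {a<..<b}) (nhds x)"
      using x by (intro eventually_nhds_in_open) auto
    then have ev: "eventually (\<lambda>y. g y = f y) (nhds x)"
      by eventually_elim (auto simp: g_def)
    have "(f has_real_derivative f' x) (at x)" using x deriv by auto
    then have "(g has_real_derivative f' x) (at x)"
      using DERIV_cong_ev[OF refl ev refl] by simp
    then show ?thesis by (simp add: has_real_derivative_iff_has_vector_derivative)
  qed
  ultimately have "(f' has_integral (g b - g a)) {a..b}"
    using ab by (intro fundamental_theorem_of_calculus_interior) auto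
  then show ?thesis using ab by (simp add: g_def)
qed

section \<open>The sums as alternating series\<close>

definition increasing_tuples :: "nat \<Rightarrow> nat \<Rightarrow> (nat \<Rightarrow> nat) set" where
  "increasing_tuples r N = {n \<in> {1..r} \<rightarrow>\<^sub>E {1..N}. strict_mono_on {1..r} n}"

lemma T_partial_0: "T_partial 0 k \<sigma> N = 1"
  by (simp add: T_partial_def strict_mono_on_def)

lemma finite_increasing_tuples: "finite (increasing_tuples r N)"
  unfolding increasing_tuples_def by (rule finite_subset[of _ "{1..r} \<rightarrow>\<^sub>E {1..N}"]) (auto intro: finite_PiE)

lemma increasing_tuples_extend:
  assumes f: "f \<in> increasing_tuples r (a - 1)" and a: "a \<in> {1..N}"
  shows "f(Suc r := a) \<in> increasing_tuples (Suc r) N"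
proof -
  have f1: "f j \<in> {1..a - 1}" if "j \<in> {1..r}" for j
    using f that by (auto simp: increasing_tuples_def PiE_iff)
  have "f(Suc r := a) \<in> {1..Suc r} \<rightarrow>\<^sub>E {1..N}"
    using f f1 a by (fastforce simp: increasing_tuples_def PiE_iff extensional_def)
  moreover have "strict_mono_on {1..Suc r} (f(Suc r := a))"
  proof (rule strict_mono_onI)
    fix i j assume ij: "i \<in> {1..Suc r}" "j \<in> {1..Suc r}" "i < j"
    show "(f(Suc r := a)) i < (f(Suc r := a)) j"
    proof (cases "j = Suc r")
      case True
      then show ?thesis using f1[of i] ij a by force
    next
      case False
      then show ?thesis using f ij
        by (auto simp: increasing_tuples_def strict_mono_on_def)
    qed
  qed
  ultimately show ?thesis by (simp add: increasing_tuples_def)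
qed

lemma increasing_tuples_truncate:
  assumes f: "f \<in> increasing_tuples (Suc r) N"
  shows "f (Suc r) \<in> {1..N}" and "f(Suc r := undefined) \<in> increasing_tuples r (f (Suc r) - 1)"
proof -
  have f1: "f j \<in> {1..N}" if "j \<in> {1..Suc r}" for j
    using f that by (auto simp: increasing_tuples_def PiE_iff)
  then show "f (Suc r) \<in> {1..N}" by auto
  have mono: "f i < f j" if "i \<in> {1..Suc r}" "j \<in> {1..Suc r}" "i < j" for i j
    using f that unfolding increasing_tuples_def strict_mono_on_def by auto
  have "f(Suc r := undefined) \<in> {1..r} \<rightarrow>\<^sub>E {1..f (Suc r) - 1}"
  proof
    fix j assume j: "j \<in> {1..r}"
    then show "(f(Suc r := undefined)) j \<in> {1..f (Suc r) - 1}"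
      using f1[of j] mono[of j "Suc r"] by auto
  next
    fix j assume "j \<notin> {1..r}"
    then show "(f(Suc r := undefined)) j = undefined"
      using f by (cases "j = Suc r") (auto simp: increasing_tuples_def PiE_iff extensional_def)
  qed
  moreover have "strict_mono_on {1..r} (f(Suc r := undefined))"
    using mono by (auto simp: strict_mono_on_def)
  ultimately show "f(Suc r := undefined) \<in> increasing_tuples r (f (Suc r) - 1)"
    by (simp add: increasing_tuples_def)
qed

lemma T_partial_Suc:
  "T_partial (Suc r) k \<sigma> N =
     (\<Sum>n = 1..N. 2 * of_int (\<sigma> (Suc r)) ^ n / (2 * real n - real (Suc r)) ^ k (Suc r) * T_partial r k \<sigma> (n - 1))"
proof -
  let ?t = "\<lambda>n j. of_int (\<sigma> j) ^ n j / (2 * real (n j) - real j) ^ k j"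
  have "(\<Sum>n \<in> increasing_tuples (Suc r) N. \<Prod>j = 1..Suc r. ?t n j) =
    (\<Sum>(a, f) \<in> Sigma {1..N} (\<lambda>a. increasing_tuples r (a - 1)).
       of_int (\<sigma> (Suc r)) ^ a / (2 * real a - real (Suc r)) ^ k (Suc r) * (\<Prod>j = 1..r. ?t f j))"
  proof (rule sum.reindex_bij_witness[where i = "\<lambda>(a, f). f(Suc r := a)"
        and j = "\<lambda>f. (f (Suc r), f(Suc r := undefined))"], goal_cases)
    case (1 f)
    then show ?case by auto
  next
    case (2 f)
    then show ?case using increasing_tuples_truncate[of f r N] by auto
  next
    case (3 p)
    then obtain a f where p: "p = (a, f)" "f \<in> increasing_tuples r (a - 1)" by auto
    then have "f (Suc r) = undefined" by (auto simp: increasing_tuples_def PiE_iff extensional_def)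
    then show ?case using p by (auto simp: fun_upd_idem)
  next
    case (4 p)
    then show ?case using increasing_tuples_extend by auto
  next
    case (5 f)
    have "(\<Prod>j = 1..r. ?t (f(Suc r := undefined)) j) = (\<Prod>j = 1..r. ?t f j)"
      by (rule prod.cong) auto
    then show ?case by (simp add: mult.commute)
  qed
  also have "\<dots> = (\<Sum>a = 1..N. \<Sum>f \<in> increasing_tuples r (a - 1).
       of_int (\<sigma> (Suc r)) ^ a / (2 * real a - real (Suc r)) ^ k (Suc r) * (\<Prod>j = 1..r. ?t f j))"
    by (rule sum.Sigma[symmetric]) (auto simp: finite_increasing_tuples)
  finally have main: "(\<Sum>n \<in> increasing_tuples (Suc r) N. \<Prod>j = 1..Suc r. ?t n j) = \<dots>" .
  have T: "T_partial r k \<sigma> N = 2 ^ r * (\<Sum>n \<in> increasing_tuples r N. \<Prod>j = 1..r. ?t n j)" for r N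
    by (simp add: T_partial_def increasing_tuples_def)
  show ?thesis
    unfolding T main sum_distrib_left by (intro sum.cong refl) simp
qed

text \<open>
  The sign attached to the step from position \<open>i\<close> to \<open>i + 1\<close>. Writing the product of bars
  as \<open>\<Prod> \<epsilon>\<^sub>i^(n\<^bsub>i+1\<^esub> - n\<^sub>i)\<close> with \<open>n\<^sub>0 = 0\<close>, bars at positions \<open>l\<close> and \<open>r\<close> mean
  \<open>\<epsilon>\<^sub>i = - 1\<close> exactly for \<open>l \<le> i < r\<close>; the convention \<open>n\<^sub>0 = 0\<close> covers \<open>l = 0\<close>.
\<close>

definition twist :: "nat \<Rightarrow> nat \<Rightarrow> real" where
  "twist l i = (if i < l then 1 else - 1)"

text \<open>
  The part of the nested sum with the outermost index fixed. The index is shifted to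
  \<open>n = n\<^sub>i - i\<close>: the strictly increasing \<open>n\<^sub>i\<close> become weakly increasing, and the denominator
  \<open>2 n\<^sub>i - i\<close> becomes \<open>2 n + i\<close>.
\<close>

primrec word_coeff :: "(nat \<Rightarrow> nat) \<Rightarrow> nat \<Rightarrow> nat \<Rightarrow> nat \<Rightarrow> real" where
  "word_coeff k l 0 n = (if n = 0 then 1 else 0)"
| "word_coeff k l (Suc i) n =
     2 / real (2 * n + i + 1) ^ k (Suc i) * (\<Sum>m\<le>n. twist l i ^ (n - m + 1) * word_coeff k l i m)"

lemma sum_up_to_shift:
  fixes g :: "nat \<Rightarrow> real"
  shows "(\<Sum>n = i..N + i. g n) = (\<Sum>m\<le>N. g (m + i))"
  by (simp add: sum.shift_bounds_cl_nat_ivl[of g 0 i N, simplified] atLeast0AtMost)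

text \<open>
  The signs of the two descriptions agree only for a complete word: at an intermediate position
  \<open>l \<le> i < r\<close> the step signs have already put a bar on \<open>n\<^sub>i\<close>, whence the factor \<open>(- 1)\<^sup>n\<close>.
\<close>

lemma T_partial_eq_sum_word_coeff:
  assumes "l < r" "i \<le> r"
  shows "T_partial i k (bar_signs l r) N =
    (\<Sum>n = i..N. (if i < l \<or> i = r then 1 else (- 1) ^ n) * word_coeff k l i (n - i))"
  using assms(2)
proof (induction i arbitrary: N)
  case 0
  have "(\<Sum>n = 0..N. (if 0 < l \<or> 0 = r then 1 else (- 1) ^ n) * word_coeff k l 0 (n - 0)) =
    (\<Sum>n \<in> {0}. (if 0 < l \<or> 0 = r then 1 else (- 1) ^ n) * word_coeff k l 0 (n - 0))"
    by (rule sum.mono_neutral_right) auto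
  then show ?case by (simp add: T_partial_0)
next
  case (Suc i)
  let ?s = "\<lambda>i n. (if i < l \<or> i = r then 1 else (- 1) ^ n) :: real"
  let ?c = "\<lambda>n. 2 * of_int (bar_signs l r (Suc i)) ^ n / (2 * real n - real (Suc i)) ^ k (Suc i)"
  have ih: "T_partial i k (bar_signs l r) N = (\<Sum>n = i..N. ?s i n * word_coeff k l i (n - i))" for N
    using Suc.IH Suc.prems by simp
  have summand: "?c n * T_partial i k (bar_signs l r) (n - 1) = ?s (Suc i) n * word_coeff k l (Suc i) (n - Suc i)"
    if n: "n \<ge> Suc i" for n
  proof -
    obtain d where d: "n = d + Suc i" using n le_Suc_ex by (metis add.commute)
    have "T_partial i k (bar_signs l r) (n - 1) = (\<Sum>m\<le>d. ?s i (m + i) * word_coeff k l i m)"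
    proof -
      have "n - 1 = d + i" by (simp add: d)
      then show ?thesis by (simp only: ih sum_up_to_shift diff_add_inverse2)
    qed
    note Tsum = this
    have signs: "of_int (bar_signs l r (Suc i)) ^ n * ?s i (m + i) = ?s (Suc i) n * twist l i ^ (d - m + 1)"
      if md: "m \<le> d" for m
    proof -
      obtain e where e: "d = m + e" using le_Suc_ex[OF md] by auto
      have sq: "(- 1 :: real) ^ x * (- 1) ^ x = 1" for x
        by (metis mult_minus1 mult_minus_left minus_minus power_mult_distrib power_one mult_1)
      consider "Suc i < l" | "Suc i = l" "Suc i < r" | "l \<le> i" "Suc i < r" | "l \<le> i" "Suc i = r"
        using Suc.prems assms(1) by linarith
      then show ?thesis
      proof cases
        case 4
        have "(- 1 :: real) ^ m * (- 1) ^ e * (- 1) ^ i * ((- 1) ^ m * (- 1) ^ i) =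
            ((- 1) ^ m * (- 1) ^ m) * ((- 1) ^ i * (- 1) ^ i) * (- 1) ^ e"
          by (simp only: mult_ac)
        then show ?thesis
          using 4(1) by (simp add: bar_signs_def twist_def d e power_add sq flip: 4(2))
      qed (use assms(1) in \<open>simp_all add: bar_signs_def twist_def d e power_add sq\<close>)
    qed
    have "of_int (bar_signs l r (Suc i)) ^ n * T_partial i k (bar_signs l r) (n - 1) =
      ?s (Suc i) n * (\<Sum>m\<le>d. twist l i ^ (d - m + 1) * word_coeff k l i m)"
      unfolding Tsum sum_distrib_left
      by (intro sum.cong refl) (simp only: mult.assoc[symmetric] atMost_iff signs)
    moreover have "2 * real n - real (Suc i) = real (2 * d + i + 1)" by (simp add: d)
    ultimately show ?thesis by (simp add: d divide_simps)
  qed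
  have "T_partial (Suc i) k (bar_signs l r) N = (\<Sum>n = 1..N. ?c n * T_partial i k (bar_signs l r) (n - 1))"
    by (rule T_partial_Suc)
  also have "\<dots> = (\<Sum>n = Suc i..N. ?c n * T_partial i k (bar_signs l r) (n - 1))"
    by (rule sum.mono_neutral_right) (auto simp: ih)
  also have "\<dots> = (\<Sum>n = Suc i..N. ?s (Suc i) n * word_coeff k l (Suc i) (n - Suc i))"
    by (rule sum.cong) (use summand in auto)
  finally show ?case by simp
qed

lemma sum_inverse_sqrt_le: "(\<Sum>m\<le>n. 1 / sqrt (real m + 1)) \<le> 2 * sqrt (real n + 1)"
proof (induction n)
  case (Suc n)
  have a: "sqrt (real n + 1) * sqrt (real n + 2) \<le> real n + 3 / 2"
    unfolding real_sqrt_mult[symmetric] by (rule real_le_lsqrt) (auto simp: power2_eq_square algebra_simps)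
  have "2 * sqrt (real n + 1) + 1 / sqrt (real n + 2) \<le> 2 * sqrt (real n + 2)"
    using a by (simp add: field_simps)
  with Suc show ?case by (simp add: add.commute)
qed auto

lemma null_seq_inverse_sqrt: "(\<lambda>n. c / sqrt (real n + 1)) \<longlonglongrightarrow> 0"
proof -
  have "filterlim (\<lambda>n. real (Suc n)) at_top sequentially"
    by (rule filterlim_compose[OF filterlim_real_sequentially filterlim_Suc])
  then have "filterlim (\<lambda>n. sqrt (real n + 1)) at_top sequentially"
    by (intro filterlim_compose[OF sqrt_at_top]) (simp add: add.commute)
  then show ?thesis by (rule real_tendsto_divide_at_top[OF tendsto_const])
qed

text \<open>
  The true size is a power of \<open>ln n\<close> divided by \<open>n\<close>. The crude bound is stable under the
  recursion because \<open>\<Sum> 1 / \<surd>m\<close> is \<open>O(\<surd>n)\<close>.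
\<close>

lemma word_coeff_bound:
  assumes k: "\<And>j. j \<in> {1..i} \<Longrightarrow> k j \<ge> 1"
  shows "\<bar>word_coeff k l i n\<bar> \<le> 4 ^ i / sqrt (real n + 1)"
  using k
proof (induction i arbitrary: n)
  case (Suc i)
  have "\<bar>\<Sum>m\<le>n. twist l i ^ (n - m + 1) * word_coeff k l i m\<bar> \<le> (\<Sum>m\<le>n. 4 ^ i / sqrt (real m + 1))"
    using Suc.IH Suc.prems
    by (intro order.trans[OF sum_abs] sum_mono) (auto simp: abs_mult power_abs twist_def)
  also have "\<dots> = 4 ^ i * (\<Sum>m\<le>n. 1 / sqrt (real m + 1))" by (simp add: sum_distrib_left)
  also have "\<dots> \<le> 4 ^ i * (2 * sqrt (real n + 1))"
    by (intro mult_left_mono sum_inverse_sqrt_le) auto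
  finally have S: "\<bar>\<Sum>m\<le>n. twist l i ^ (n - m + 1) * word_coeff k l i m\<bar> \<le> 4 ^ i * (2 * sqrt (real n + 1))" .
  have "real n + 1 \<le> real (2 * n + i + 1) ^ 1" by simp
  also have "\<dots> \<le> real (2 * n + i + 1) ^ k (Suc i)"
    using Suc.prems[of "Suc i"] by (intro power_increasing) auto
  finally have D: "2 / real (2 * n + i + 1) ^ k (Suc i) \<le> 2 / (real n + 1)"
    by (intro divide_left_mono) auto
  have "\<bar>word_coeff k l (Suc i) n\<bar> \<le> 2 / (real n + 1) * (4 ^ i * (2 * sqrt (real n + 1)))"
    unfolding word_coeff.simps abs_mult
    by (intro mult_mono S) (use D in auto)
  also have "\<dots> = 4 ^ Suc i * (sqrt (real n + 1) / (real n + 1))" by simp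
  also have "sqrt (real n + 1) / (real n + 1) = 1 / sqrt (real n + 1)"
    by (subst sqrt_divide_self_eq) (auto simp: inverse_eq_divide)
  finally show ?case by simp
qed auto

text \<open>
  Twice the series is a telescoping series plus a series dominated by the variation of \<open>c\<close>.
\<close>

lemma summable_alternating_bounded_variation:
  fixes c :: "nat \<Rightarrow> real"
  assumes c0: "c \<longlonglongrightarrow> 0" and var: "summable (\<lambda>n. \<bar>c n - c (Suc n)\<bar>)"
  shows "summable (\<lambda>n. (- 1) ^ n * c n)"
proof -
  have "(\<lambda>n. (- 1) ^ n * c n) \<longlonglongrightarrow> 0"
    by (rule Lim_null_comparison[OF _ tendsto_rabs_zero[OF c0]]) (auto simp: abs_mult power_abs)
  then have "summable (\<lambda>n. (- 1) ^ n * c n - (- 1) ^ Suc n * c (Suc n))"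
    by (rule telescope_summable')
  moreover have "summable (\<lambda>n. (- 1) ^ n * (c n - c (Suc n)))"
    by (rule summable_comparison_test'[OF var, of 0]) (auto simp: abs_mult power_abs)
  ultimately have "summable (\<lambda>n. 1 / 2 * ((- 1) ^ n * c n - (- 1) ^ Suc n * c (Suc n) + (- 1) ^ n * (c n - c (Suc n))))"
    by (intro summable_mult summable_add)
  then show ?thesis by (simp add: algebra_simps)
qed

text \<open>
  Bernoulli's inequality for \<open>(a / (a + 2))\<^sup>k\<close>. The bound is uniform in the exponent up to the factor
  \<open>k\<close>, so that the last exponent of a word needs no case distinction.
\<close>

lemma inverse_power_diff_bound:
  fixes a :: real
  assumes a: "a \<ge> 1" and k: "k \<ge> 1"
  shows "\<bar>1 / a ^ k - 1 / (a + 2) ^ k\<bar> \<le> 2 * k / a ^ 2"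
proof -
  have "1 + real k * (- 2 / (a + 2)) \<le> (1 + (- 2 / (a + 2))) ^ k"
    by (rule Bernoulli_inequality) (use a in \<open>simp add: field_simps\<close>)
  also have "1 + (- 2 / (a + 2)) = a / (a + 2)" using a by (simp add: field_simps)
  finally have "1 - (a / (a + 2)) ^ k \<le> 2 * k / (a + 2)" by simp
  also have "\<dots> \<le> 2 * k / a" using a by (intro divide_left_mono) auto
  finally have 1: "1 - (a / (a + 2)) ^ k \<le> 2 * k / a" .
  have "(a / (a + 2)) ^ k \<le> 1" using a by (intro power_le_one) auto
  then have "\<bar>1 / a ^ k - 1 / (a + 2) ^ k\<bar> = 1 / a ^ k * (1 - (a / (a + 2)) ^ k)"
    using a by (subst abs_of_nonneg) (auto simp: power_divide field_simps)
  also have "\<dots> \<le> 1 / a ^ k * (2 * k / a)" using a 1 by (intro mult_left_mono) auto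
  also have "\<dots> \<le> 1 / a ^ 1 * (2 * k / a)"
    using a k by (intro mult_right_mono divide_left_mono power_increasing) auto
  finally show ?thesis by (simp add: power2_eq_square)
qed

lemma summable_inverse_three_halves: "summable (\<lambda>n. 1 / ((real n + 1) * sqrt (real n + 1)))"
proof -
  have "summable (\<lambda>n. real (Suc n) powr (- 3 / 2))"
    by (subst summable_Suc_iff[where f = "\<lambda>n. real n powr (- 3 / 2)"]) (simp add: summable_real_powr_iff)
  moreover have "real (Suc n) powr (- 3 / 2) = 1 / ((real n + 1) * sqrt (real n + 1))" for n
  proof -
    have "real (Suc n) powr (- (1 + 1 / 2)) = 1 / (real (Suc n) powr (1 + 1 / 2))"
      by (simp add: powr_minus_divide)
    also have "real (Suc n) powr (1 + 1 / 2) = real (Suc n) * sqrt (real (Suc n))"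
      by (subst powr_add) (simp add: powr_half_sqrt)
    finally show ?thesis by (simp add: add.commute)
  qed
  ultimately show ?thesis by simp
qed

text \<open>
  The last step carries the sign \<open>- 1\<close>, so the series is \<open>\<Sum> (- 1)\<^sup>n c n\<close> where \<open>c n\<close> is a partial
  sum of the previous level divided by a power of \<open>2 n + i + 1\<close>. The partial sums need not be
  monotone, because of the inner bar, but \<open>c n - c (n + 1) = O(n\<^bsup>-3/2\<^esup>)\<close>.
\<close>

lemma summable_word_coeff:
  assumes k: "\<And>j. j \<in> {1..Suc i} \<Longrightarrow> k j \<ge> 1" and l: "l \<le> i"
  shows "summable (word_coeff k l (Suc i))"
proof -
  define S where "S n = (\<Sum>m\<le>n. (- 1) ^ m * word_coeff k l i m)" for n
  define a where "a n = real (2 * n + i + 1)" for n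
  define K where "K = k (Suc i)"
  have K: "K \<ge> 1" using k by (auto simp: K_def)
  define c where "c n = - 2 / a n ^ K * S n" for n
  have sgn: "(- 1 :: real) ^ (n - m + 1) = - ((- 1) ^ n * (- 1) ^ m)" if mn: "m \<le> n" for m n :: nat
  proof -
    obtain e where "n = m + e" using mn le_Suc_ex by blast
    then show ?thesis by (simp add: power_add flip: power_mult_distrib)
  qed
  have eq: "word_coeff k l (Suc i) n = (- 1) ^ n * c n" for n
  proof -
    have "(\<Sum>m\<le>n. twist l i ^ (n - m + 1) * word_coeff k l i m) =
      (\<Sum>m\<le>n. - ((- 1) ^ n) * ((- 1) ^ m * word_coeff k l i m))"
      using l sgn by (intro sum.cong refl) (auto simp: twist_def simp del: power_Suc)
    also have "\<dots> = - ((- 1) ^ n) * S n" by (simp only: S_def sum_distrib_left)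
    finally show ?thesis by (simp add: c_def K_def a_def)
  qed
  have wb: "\<bar>word_coeff k l i n\<bar> \<le> 4 ^ i / sqrt (real n + 1)" for n
    by (rule word_coeff_bound) (use k in auto)
  have Sb: "\<bar>S n\<bar> \<le> 4 ^ i * (2 * sqrt (real n + 1))" for n
  proof -
    have "\<bar>S n\<bar> \<le> (\<Sum>m\<le>n. 4 ^ i / sqrt (real m + 1))"
      unfolding S_def using wb by (intro order.trans[OF sum_abs] sum_mono) (auto simp: abs_mult power_abs)
    also have "\<dots> = 4 ^ i * (\<Sum>m\<le>n. 1 / sqrt (real m + 1))" by (simp add: sum_distrib_left)
    also have "\<dots> \<le> 4 ^ i * (2 * sqrt (real n + 1))"
      by (intro mult_left_mono sum_inverse_sqrt_le) auto
    finally show ?thesis .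
  qed
  have an: "a n \<ge> real n + 1" "a (Suc n) = a n + 2" for n by (auto simp: a_def)
  define M where "M = 2 * (4 ^ i * 4 * K + 4 ^ i :: real)"
  have "summable (\<lambda>n. \<bar>c n - c (Suc n)\<bar>)"
  proof (rule summable_comparison_test'[where N = 0])
    show "summable (\<lambda>n. M * (1 / ((real n + 1) * sqrt (real n + 1))))"
      by (intro summable_mult summable_inverse_three_halves)
    fix n
    have dS: "S (Suc n) = S n + (- 1) ^ Suc n * word_coeff k l i (Suc n)" by (simp add: S_def)
    have "c n - c (Suc n) = - 2 * ((1 / a n ^ K - 1 / (a n + 2) ^ K) * S n)
        + 2 * (1 / (a n + 2) ^ K * ((- 1) ^ Suc n * word_coeff k l i (Suc n)))"
      unfolding c_def dS an(2) by (simp add: algebra_simps)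
    also have "\<bar>\<dots>\<bar> \<le> 2 * (\<bar>1 / a n ^ K - 1 / (a n + 2) ^ K\<bar> * \<bar>S n\<bar>)
        + 2 * (\<bar>1 / (a n + 2) ^ K\<bar> * \<bar>word_coeff k l i (Suc n)\<bar>)"
      by (rule order.trans[OF abs_triangle_ineq]) (simp add: abs_mult power_abs)
    also have "\<dots> \<le> 2 * (2 * K / (real n + 1) ^ 2 * (4 ^ i * (2 * sqrt (real n + 1))))
        + 2 * (1 / (real n + 1) * (4 ^ i / sqrt (real n + 1)))"
    proof (intro add_mono mult_left_mono mult_mono Sb)
      have "\<bar>1 / a n ^ K - 1 / (a n + 2) ^ K\<bar> \<le> 2 * K / (a n) ^ 2"
        using inverse_power_diff_bound[of "a n" K] K an(1)[of n] by simp
      also have "\<dots> \<le> 2 * K / (real n + 1) ^ 2"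
        using an(1)[of n] by (intro divide_left_mono power_mono) auto
      finally show "\<bar>1 / a n ^ K - 1 / (a n + 2) ^ K\<bar> \<le> 2 * K / (real n + 1) ^ 2" .
      have "(real n + 1) \<le> (a n + 2) ^ 1" using an(1)[of n] by simp
      also have "\<dots> \<le> (a n + 2) ^ K" using an(1)[of n] K by (intro power_increasing) auto
      finally show "\<bar>1 / (a n + 2) ^ K\<bar> \<le> 1 / (real n + 1)"
        using an(1)[of n] by (simp add: frac_le)
      show "\<bar>word_coeff k l i (Suc n)\<bar> \<le> 4 ^ i / sqrt (real n + 1)"
        by (rule order.trans[OF wb]) (auto intro!: divide_left_mono)
    qed (use an(1)[of n] in auto)
    also have "\<dots> = M * (1 / ((real n + 1) * sqrt (real n + 1)))"
    proof -
      have "sqrt (real n + 1) / (real n + 1) ^ 2 = 1 / ((real n + 1) * sqrt (real n + 1))"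
        using sqrt_divide_self_eq[of "real n + 1"]
        by (simp add: power2_eq_square inverse_eq_divide flip: divide_divide_eq_left) (simp add: mult.commute)
      moreover have "2 * (2 * K / (real n + 1) ^ 2 * (4 ^ i * (2 * sqrt (real n + 1)))) =
          8 * real K * 4 ^ i * (sqrt (real n + 1) / (real n + 1) ^ 2)"
        by simp
      moreover have "2 * (1 / (real n + 1) * (4 ^ i / sqrt (real n + 1))) =
          2 * 4 ^ i * (1 / ((real n + 1) * sqrt (real n + 1)))"
        by simp
      moreover have "8 * real K * 4 ^ i * v + 2 * 4 ^ i * v = M * v" for v :: real
        by (simp add: M_def algebra_simps)
      ultimately show ?thesis by (simp only:)
    qed
    finally show "norm \<bar>c n - c (Suc n)\<bar> \<le> M * (1 / ((real n + 1) * sqrt (real n + 1)))" by simp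
  qed
  moreover have "c \<longlonglongrightarrow> 0"
  proof (rule Lim_null_comparison)
    show "eventually (\<lambda>n. norm (c n) \<le> 4 ^ Suc i / sqrt (real n + 1)) sequentially"
    proof (intro always_eventually allI)
      fix n
      have "\<bar>word_coeff k l (Suc i) n\<bar> \<le> 4 ^ Suc i / sqrt (real n + 1)"
        by (rule word_coeff_bound) (use k in auto)
      then show "norm (c n) \<le> 4 ^ Suc i / sqrt (real n + 1)"
        unfolding eq by (simp add: abs_mult power_abs)
    qed
    show "(\<lambda>n. 4 ^ Suc i / sqrt (real n + 1)) \<longlonglongrightarrow> 0"
      by (rule null_seq_inverse_sqrt)
  qed
  ultimately have "summable (\<lambda>n. (- 1) ^ n * c n)" by (intro summable_alternating_bounded_variation)
  then show ?thesis by (simp add: eq[abs_def])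
qed


text \<open>
  The sum of \<open>word_coeff\<close> over all compositions, in the form of a recursion: \<open>q\<close> is the excess of
  the weight over the depth, and \<open>b\<close> the excess of the last exponent over \<open>1\<close>.
\<close>

primrec weight_coeff :: "nat \<Rightarrow> nat \<Rightarrow> nat \<Rightarrow> nat \<Rightarrow> real" where
  "weight_coeff l 0 q n = (if q = 0 \<and> n = 0 then 1 else 0)"
| "weight_coeff l (Suc i) q n =
     (\<Sum>b\<le>q. 2 / real (2 * n + i + 1) ^ Suc b * (\<Sum>m\<le>n. twist l i ^ (n - m + 1) * weight_coeff l i (q - b) m))"

lemma word_coeff_cong:
  "(\<And>j. j \<in> {1..i} \<Longrightarrow> k j = k' j) \<Longrightarrow> word_coeff k l i n = word_coeff k' l i n"
proof (induction i arbitrary: n)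
  case (Suc i)
  then have "word_coeff k l i m = word_coeff k' l i m" for m by auto
  moreover have "k (Suc i) = k' (Suc i)" using Suc.prems by auto
  ultimately show ?case by simp
qed auto

lemma composition_extend:
  assumes f: "f \<in> compositions (q - b + i) i" and b: "b \<le> q"
  shows "f(Suc i := Suc b) \<in> compositions (q + Suc i) (Suc i)"
proof -
  have "(\<Sum>j = 1..i. (f(Suc i := Suc b)) j) = (\<Sum>j = 1..i. f j)" by (rule sum.cong) auto
  then show ?thesis using f b
    by (auto simp: compositions_def PiE_iff extensional_def le_Suc_eq)
qed

lemma composition_truncate:
  assumes f: "f \<in> compositions (q + Suc i) (Suc i)"
  shows "f (Suc i) \<ge> 1" "f (Suc i) - 1 \<le> q"
    "f(Suc i := undefined) \<in> compositions (q - (f (Suc i) - 1) + i) i"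
proof -
  have f1: "f j \<ge> 1" if "j \<in> {1..Suc i}" for j
    using f that by (auto simp: compositions_def PiE_iff)
  then show ge: "f (Suc i) \<ge> 1" by simp
  have s: "(\<Sum>j = 1..i. f j) + f (Suc i) = q + Suc i" using f by (simp add: compositions_def)
  have "(\<Sum>j = 1..i. f j) \<ge> (\<Sum>j = 1..i. 1)" by (rule sum_mono) (use f1 in auto)
  then have s2: "(\<Sum>j = 1..i. f j) \<ge> i" by simp
  show "f (Suc i) - 1 \<le> q" using s s2 by linarith
  have "(\<Sum>j = 1..i. (f(Suc i := undefined)) j) = (\<Sum>j = 1..i. f j)" by (rule sum.cong) auto
  also have "\<dots> = q - (f (Suc i) - 1) + i" using s s2 ge by linarith
  finally show "f(Suc i := undefined) \<in> compositions (q - (f (Suc i) - 1) + i) i"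
    using f f1 by (auto simp: compositions_def PiE_iff extensional_def)
qed

lemma weight_coeff_eq_sum_word_coeff:
  "weight_coeff l i q n = (\<Sum>k \<in> compositions (q + i) i. word_coeff k l i n)"
proof (induction i arbitrary: q n)
  case 0
  have "compositions q 0 = (if q = 0 then {\<lambda>_. undefined} else {})"
    by (auto simp: compositions_def)
  then show ?case by simp
next
  case (Suc i)
  let ?g = "\<lambda>b. 2 / real (2 * n + i + 1) ^ Suc b"
  have "(\<Sum>k \<in> compositions (q + Suc i) (Suc i). word_coeff k l (Suc i) n) =
    (\<Sum>(b, f) \<in> Sigma {..q} (\<lambda>b. compositions (q - b + i) i).
       ?g b * (\<Sum>m\<le>n. twist l i ^ (n - m + 1) * word_coeff f l i m))"
  proof (rule sum.reindex_bij_witness[where i = "\<lambda>(b, f). f(Suc i := Suc b)"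
        and j = "\<lambda>f. (f (Suc i) - 1, f(Suc i := undefined))"], goal_cases)
    case (1 f)
    then show ?case using composition_truncate(1)[of f q i] by auto
  next
    case (2 f)
    then show ?case using composition_truncate[of f q i] by auto
  next
    case (3 p)
    then obtain b f where p: "p = (b, f)" "f \<in> compositions (q - b + i) i" by auto
    then have "f (Suc i) = undefined" by (auto simp: compositions_def PiE_iff extensional_def)
    then show ?case using p by (auto simp: fun_upd_idem)
  next
    case (4 p)
    then show ?case using composition_extend by auto
  next
    case (5 f)
    have "word_coeff (f(Suc i := undefined)) l i m = word_coeff f l i m" for m
      by (rule word_coeff_cong) auto
    moreover obtain a where "f (Suc i) = Suc a"
      using composition_truncate(1)[OF 5] by (cases "f (Suc i)") auto
    ultimately show ?case by simp
  qed
  also have "\<dots> = (\<Sum>b\<le>q. \<Sum>f \<in> compositions (q - b + i) i.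
       ?g b * (\<Sum>m\<le>n. twist l i ^ (n - m + 1) * word_coeff f l i m))"
    by (rule sum.Sigma[symmetric]) (auto simp: finite_compositions)
  also have "\<dots> = weight_coeff l (Suc i) q n"
    unfolding weight_coeff.simps
  proof (rule sum.cong[OF refl])
    fix b
    have "(\<Sum>f \<in> compositions (q - b + i) i. ?g b * (\<Sum>m\<le>n. twist l i ^ (n - m + 1) * word_coeff f l i m)) =
      ?g b * (\<Sum>f \<in> compositions (q - b + i) i. \<Sum>m\<le>n. twist l i ^ (n - m + 1) * word_coeff f l i m)"
      by (rule sum_distrib_left[symmetric])
    also have "(\<Sum>f \<in> compositions (q - b + i) i. \<Sum>m\<le>n. twist l i ^ (n - m + 1) * word_coeff f l i m) =
      (\<Sum>m\<le>n. twist l i ^ (n - m + 1) * weight_coeff l i (q - b) m)"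
      unfolding Suc.IH by (subst sum.swap) (simp only: sum_distrib_left)
    finally show "(\<Sum>f \<in> compositions (q - b + i) i. ?g b * (\<Sum>m\<le>n. twist l i ^ (n - m + 1) * word_coeff f l i m)) =
      ?g b * (\<Sum>m\<le>n. twist l i ^ (n - m + 1) * weight_coeff l i (q - b) m)" .
  qed
  finally show ?case by simp
qed

lemma composition_pos: "k \<in> compositions w i \<Longrightarrow> j \<in> {1..i} \<Longrightarrow> k j \<ge> 1"
  by (auto simp: compositions_def PiE_iff)

lemma weight_coeff_null: "weight_coeff l i q \<longlonglongrightarrow> 0"
proof -
  have "word_coeff k l i \<longlonglongrightarrow> 0" if "k \<in> compositions (q + i) i" for k
    by (rule Lim_null_comparison[OF _ null_seq_inverse_sqrt[of "4 ^ i"]])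
      (use word_coeff_bound composition_pos[OF that] in auto)
  then have "(\<lambda>n. \<Sum>k \<in> compositions (q + i) i. word_coeff k l i n) \<longlonglongrightarrow> (\<Sum>k \<in> compositions (q + i) i. 0)"
    by (intro tendsto_sum)
  then show ?thesis by (simp add: weight_coeff_eq_sum_word_coeff[abs_def])
qed

lemma T_eq_suminf_word_coeff:
  assumes l: "l < r" and k: "\<And>j. j \<in> {1..r} \<Longrightarrow> k j \<ge> 1"
  shows "summable (word_coeff k l r)" and "T r k (bar_signs l r) = suminf (word_coeff k l r)"
proof -
  obtain i where i: "r = Suc i" "l \<le> i" using l by (cases r) auto
  show s: "summable (word_coeff k l r)" unfolding i by (rule summable_word_coeff) (use k i in auto)
  have "T_partial r k (bar_signs l r) (N + r) = (\<Sum>m\<le>N. word_coeff k l r m)" for N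
    using T_partial_eq_sum_word_coeff[OF l order.refl, of k "N + r"] sum_up_to_shift[of _ r N]
    by simp
  then have "(\<lambda>N. T_partial r k (bar_signs l r) (N + r)) \<longlonglongrightarrow> suminf (word_coeff k l r)"
    using summable_LIMSEQ'[OF s] by simp
  then show "T r k (bar_signs l r) = suminf (word_coeff k l r)"
    unfolding T_def by (rule limI[OF LIMSEQ_offset])
qed

lemma W_eq_suminf_weight_coeff:
  assumes l: "l < r"
  shows "summable (weight_coeff l r q)" and "W l (q + r) r = suminf (weight_coeff l r q)"
proof -
  have s: "summable (word_coeff k l r)" if "k \<in> compositions (q + r) r" for k
    using T_eq_suminf_word_coeff(1)[OF l] composition_pos[OF that] by blast
  then show "summable (weight_coeff l r q)"
    unfolding weight_coeff_eq_sum_word_coeff[abs_def] by (rule summable_sum)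
  have "W l (q + r) r = (\<Sum>k \<in> compositions (q + r) r. suminf (word_coeff k l r))"
    unfolding W_def using T_eq_suminf_word_coeff(2)[OF l] composition_pos by (intro sum.cong) blast+
  also have "\<dots> = suminf (weight_coeff l r q)"
    unfolding weight_coeff_eq_sum_word_coeff[abs_def] by (rule suminf_sum[OF s, symmetric])
  finally show "W l (q + r) r = suminf (weight_coeff l r q)" .
qed

section \<open>Generating functions along the iterated integral\<close>

declare weight_coeff.simps(2) [simp del]

lemma DERIV_divided_power:
  assumes "(f has_real_derivative f') (at x)"
  shows "((\<lambda>x. f x ^ b / fact b) has_real_derivative
    ((if b = 0 then 0 else f x ^ (b - 1) / fact (b - 1)) * f')) (at x)"
proof (cases b)
  case (Suc c)
  have "((\<lambda>x. f x ^ Suc c / fact (Suc c)) has_real_derivative (real (Suc c) * f' * f x ^ c / fact (Suc c))) (at x)"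
    using DERIV_cdivide[OF DERIV_power_Suc[OF assms, of c], of "fact (Suc c)"] by (simp add: mult_ac)
  moreover have "real (Suc c) * f' * f x ^ c / fact (Suc c) = f x ^ c / fact c * f'"
    by (simp add: fact_Suc del: of_nat_Suc)
  ultimately show ?thesis by (simp only: Suc diff_Suc_1 nat.distinct if_False)
qed auto

lemma summable_weight_coeff_powser: "\<bar>z\<bar> < 1 \<Longrightarrow> summable (\<lambda>n. weight_coeff l i q n * z ^ n)"
proof -
  obtain C where "\<And>n. \<bar>weight_coeff l i q n\<bar> \<le> C"
    using convergent_imp_Bseq[of "weight_coeff l i q"] weight_coeff_null[of l i q]
    by (auto simp: convergent_def Bseq_def)
  then show "\<bar>z\<bar> < 1 \<Longrightarrow> ?thesis" by (rule summable_bounded_powser)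
qed

text \<open>
  Multiplication by the denominator lowers the last exponent by one, unless it is \<open>1\<close>. It is here
  that summing over all compositions pays off: an iterated sum with arbitrary exponents becomes a
  first-order system.
\<close>

lemma weight_coeff_rec:
  "real (2 * n + i + 1) * weight_coeff l (Suc i) q n =
     (if q = 0 then 0 else weight_coeff l (Suc i) (q - 1) n)
     + 2 * (\<Sum>m\<le>n. twist l i ^ (n - m + 1) * weight_coeff l i q m)"
proof -
  define D where "D = real (2 * n + i + 1)"
  have D: "D \<noteq> 0" by (simp add: D_def)
  define S where "S q = (\<Sum>m\<le>n. twist l i ^ (n - m + 1) * weight_coeff l i q m)" for q
  have w: "weight_coeff l (Suc i) q n = (\<Sum>b\<le>q. 2 / D ^ Suc b * S (q - b))" for q
    by (simp only: weight_coeff.simps S_def D_def)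
  have "D * weight_coeff l (Suc i) q n =
     (if q = 0 then 0 else weight_coeff l (Suc i) (q - 1) n) + 2 * S q"
  proof (cases q)
    case 0
    then show ?thesis using D by (simp only: w) simp
  next
    case (Suc p)
    have "D * weight_coeff l (Suc i) q n = D * (2 / D * S q) + D * (\<Sum>b\<le>p. 2 / D ^ Suc (Suc b) * S (p - b))"
      unfolding w Suc sum.atMost_Suc_shift by (simp add: distrib_left)
    also have "D * (\<Sum>b\<le>p. 2 / D ^ Suc (Suc b) * S (p - b)) = (\<Sum>b\<le>p. 2 / D ^ Suc b * S (p - b))"
      unfolding sum_distrib_left using D by (intro sum.cong) auto
    also have "D * (2 / D * S q) = 2 * S q" using D by simp
    finally show ?thesis by (simp only: w Suc) simp
  qed
  then show ?thesis unfolding D_def S_def .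
qed

definition weight_gf :: "nat \<Rightarrow> nat \<Rightarrow> nat \<Rightarrow> real \<Rightarrow> real" where
  "weight_gf l i q u = u ^ i * (\<Sum>n. weight_coeff l i q n * (u ^ 2) ^ n)"

lemma geometric_convolution:
  fixes c :: "nat \<Rightarrow> real"
  assumes c: "\<And>z. \<bar>z\<bar> < 1 \<Longrightarrow> summable (\<lambda>n. c n * z ^ n)"
    and e: "\<bar>e\<bar> = 1" and z: "\<bar>z\<bar> < 1"
  shows "(\<lambda>n. (\<Sum>m\<le>n. e ^ (n - m + 1) * c m) * z ^ n) sums (e / (1 - e * z) * (\<Sum>n. c n * z ^ n))"
proof -
  have ez: "norm (e * z) < 1" using e z by (simp add: abs_mult)
  have 1: "summable (\<lambda>n. norm (c n * z ^ n))"
    by (rule powser_insidea[OF c[of "(1 + \<bar>z\<bar>) / 2"]]) (use z in auto)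
  have 2: "summable (\<lambda>n. norm ((e * z) ^ n))"
    unfolding norm_power by (rule summable_geometric) (use ez in simp)
  have "(\<lambda>n. \<Sum>m\<le>n. (c m * z ^ m) * (e * z) ^ (n - m)) sums ((\<Sum>n. c n * z ^ n) * (\<Sum>n. (e * z) ^ n))"
    by (rule Cauchy_product_sums[OF 1 2])
  then have "(\<lambda>n. e * (\<Sum>m\<le>n. (c m * z ^ m) * (e * z) ^ (n - m))) sums
      (e * ((\<Sum>n. c n * z ^ n) * (\<Sum>n. (e * z) ^ n)))"
    by (rule sums_mult)
  moreover have "e * (\<Sum>m\<le>n. (c m * z ^ m) * (e * z) ^ (n - m)) = (\<Sum>m\<le>n. e ^ (n - m + 1) * c m) * z ^ n" for n
    unfolding sum_distrib_left sum_distrib_right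
    by (intro sum.cong refl) (simp add: power_mult_distrib flip: power_add)
  ultimately show ?thesis using suminf_geometric[OF ez] by simp
qed

text \<open>
  The generating function version of the preceding recursion: in \<open>u\<^bsup>2n+i\<^esup>\<close> the denominators are
  the effect of \<open>u d/du\<close>, and partial summation is multiplication by a geometric series.
\<close>

lemma weight_gf_deriv:
  assumes u: "0 < u" "u < 1"
  shows "(weight_gf l (Suc i) q has_real_derivative
    ((if q = 0 then 0 else weight_gf l (Suc i) (q - 1) u) / u
      + 2 * twist l i / (1 - twist l i * u ^ 2) * weight_gf l i q u)) (at u)"
proof -
  define Y where "Y = u ^ 2"
  have Y: "0 < Y" "Y < 1" using u by (auto simp: Y_def power_less_one_iff)
  define w where "w = weight_coeff l (Suc i) q"
  define F' where "F' = (\<Sum>n. diffs w n * Y ^ n)"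
  define e where "e = twist l i"
  have s: "summable (\<lambda>n. weight_coeff l i q n * Y ^ n)" for l i q
    using summable_weight_coeff_powser Y by auto
  have d: "((\<lambda>z. \<Sum>n. w n * z ^ n) has_real_derivative F') (at Y)"
    unfolding F'_def w_def
    by (rule termdiffs_strong'[where K = 1]) (use Y summable_weight_coeff_powser in auto)
  have sd: "summable (\<lambda>n. diffs w n * Y ^ n)"
    unfolding w_def by (rule termdiff_converges[where K = 1]) (use Y summable_weight_coeff_powser in auto)
  have Ysums: "(\<lambda>n. real n * w n * Y ^ n) sums (Y * F')"
  proof -
    have "(\<lambda>n. Y * (diffs w n * Y ^ n)) sums (Y * F')"
      unfolding F'_def using sd by (intro sums_mult summable_sums)
    then have "(\<lambda>n. real (Suc n) * w (Suc n) * Y ^ Suc n) sums (Y * F')"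
      by (simp add: diffs_def mult_ac)
    then show ?thesis by (subst (asm) sums_Suc_iff) simp
  qed
  have "(\<lambda>n. 2 * (real n * w n * Y ^ n) + real (Suc i) * (w n * Y ^ n)) sums
     (2 * (Y * F') + real (Suc i) * (\<Sum>n. w n * Y ^ n))"
    by (intro sums_add sums_mult Ysums summable_sums) (use s in \<open>simp add: w_def\<close>)
  moreover have "2 * (real n * w n * Y ^ n) + real (Suc i) * (w n * Y ^ n) =
     (if q = 0 then 0 else weight_coeff l (Suc i) (q - 1) n) * Y ^ n
       + 2 * ((\<Sum>m\<le>n. e ^ (n - m + 1) * weight_coeff l i q m) * Y ^ n)" for n
  proof -
    have "2 * (real n * w n * Y ^ n) + real (Suc i) * (w n * Y ^ n) = (real (2 * n + i + 1) * w n) * Y ^ n"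
      by (simp add: algebra_simps)
    then show ?thesis unfolding w_def weight_coeff_rec by (simp only: e_def algebra_simps)
  qed
  ultimately have 1: "(\<lambda>n. (if q = 0 then 0 else weight_coeff l (Suc i) (q - 1) n) * Y ^ n
       + 2 * ((\<Sum>m\<le>n. e ^ (n - m + 1) * weight_coeff l i q m) * Y ^ n)) sums
     (2 * (Y * F') + real (Suc i) * (\<Sum>n. w n * Y ^ n))" by simp
  have 2: "(\<lambda>n. (if q = 0 then 0 else weight_coeff l (Suc i) (q - 1) n) * Y ^ n
       + 2 * ((\<Sum>m\<le>n. e ^ (n - m + 1) * weight_coeff l i q m) * Y ^ n)) sums
     ((if q = 0 then 0 else \<Sum>n. weight_coeff l (Suc i) (q - 1) n * Y ^ n)
       + 2 * (e / (1 - e * Y) * (\<Sum>n. weight_coeff l i q n * Y ^ n)))"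
  proof (intro sums_add sums_mult geometric_convolution)
    show "(\<lambda>n. (if q = 0 then 0 else weight_coeff l (Suc i) (q - 1) n) * Y ^ n) sums
       (if q = 0 then 0 else \<Sum>n. weight_coeff l (Suc i) (q - 1) n * Y ^ n)"
      using s by (auto intro: summable_sums)
  qed (use Y summable_weight_coeff_powser in \<open>auto simp: e_def twist_def\<close>)
  have ode: "2 * (Y * F') + real (Suc i) * (\<Sum>n. w n * Y ^ n) =
     (if q = 0 then 0 else \<Sum>n. weight_coeff l (Suc i) (q - 1) n * Y ^ n)
       + 2 * (e / (1 - e * Y) * (\<Sum>n. weight_coeff l i q n * Y ^ n))"
    by (rule sums_unique2[OF 1 2])
  have "((\<lambda>u. u ^ Suc i * (\<Sum>n. w n * (u ^ 2) ^ n)) has_real_derivative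
      (real (Suc i) * u ^ i * (\<Sum>n. w n * Y ^ n) + (F' * (2 * u)) * u ^ Suc i)) (at u)"
  proof -
    have "((\<lambda>u. \<Sum>n. w n * (u ^ 2) ^ n) has_real_derivative (F' * (2 * u))) (at u)"
      by (rule DERIV_chain2[where f = "\<lambda>z. \<Sum>n. w n * z ^ n" and g = "\<lambda>u. u ^ 2"])
        (use d in \<open>auto simp: Y_def intro!: derivative_eq_intros\<close>)
    from DERIV_mult[OF DERIV_pow[of "Suc i" u] this] show ?thesis by (simp add: Y_def)
  qed
  moreover have "real (Suc i) * u ^ i * (\<Sum>n. w n * Y ^ n) + (F' * (2 * u)) * u ^ Suc i =
     u ^ i * (2 * (Y * F') + real (Suc i) * (\<Sum>n. w n * Y ^ n))"
    by (simp add: Y_def power2_eq_square algebra_simps)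
  moreover have "u ^ i * (2 * (Y * F') + real (Suc i) * (\<Sum>n. w n * Y ^ n)) =
     (if q = 0 then 0 else weight_gf l (Suc i) (q - 1) u) / u
      + 2 * twist l i / (1 - twist l i * u ^ 2) * weight_gf l i q u"
    unfolding ode using u by (simp add: weight_gf_def Y_def e_def distrib_left)
  ultimately have "((\<lambda>u. u ^ Suc i * (\<Sum>n. w n * (u ^ 2) ^ n)) has_real_derivative
     ((if q = 0 then 0 else weight_gf l (Suc i) (q - 1) u) / u
      + 2 * twist l i / (1 - twist l i * u ^ 2) * weight_gf l i q u)) (at u)"
    by (simp only:)
  then show ?thesis by (simp only: weight_gf_def[abs_def] w_def)
qed

definition cayley :: "real \<Rightarrow> real" where "cayley t = (1 - t) / (1 + t)"

definition cayley_log :: "real \<Rightarrow> real" where "cayley_log t = - ln (cayley t)"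

text \<open>
  The convolution with powers of \<open>- ln u\<close> removes the term of \<open>weight_gf_deriv\<close> that lowers \<open>q\<close>,
  so that each step becomes a plain integration. At \<open>t = 0\<close> the logarithm vanishes and only the
  term \<open>b = 0\<close> survives.
\<close>

definition chain :: "nat \<Rightarrow> nat \<Rightarrow> nat \<Rightarrow> real \<Rightarrow> real" where
  "chain l i q t = (\<Sum>b\<le>q. cayley_log t ^ b / fact b * weight_gf l i (q - b) (cayley t))"

definition chain_kernel :: "nat \<Rightarrow> nat \<Rightarrow> real \<Rightarrow> real" where
  "chain_kernel l i t = (if i < l then - 1 / t else 2 / (1 + t ^ 2))"

lemma cayley_bounds: "0 < t \<Longrightarrow> t < 1 \<Longrightarrow> 0 < cayley t \<and> cayley t < 1"
  by (auto simp: cayley_def)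

lemma cayley_deriv: "0 < t \<Longrightarrow> (cayley has_real_derivative (- 2 / (1 + t) ^ 2)) (at t)"
  unfolding cayley_def[abs_def]
  by (auto intro!: derivative_eq_intros simp: power2_eq_square field_simps)

lemma cayley_log_deriv:
  assumes "0 < t" "t < 1"
  shows "(cayley_log has_real_derivative (2 / (1 - t ^ 2))) (at t)"
proof -
  have "(cayley_log has_real_derivative - (- 2 / (1 + t) ^ 2 / cayley t)) (at t)"
    unfolding cayley_log_def[abs_def]
    using DERIV_minus[OF DERIV_chain2[OF DERIV_ln_divide cayley_deriv]] assms cayley_bounds[OF assms] by (simp add: mult_ac)
  moreover have "- (- 2 / (1 + t) ^ 2 / cayley t) = 2 / (1 - t ^ 2)"
  proof -
    have "(1 + t) ^ 2 * cayley t = 1 - t ^ 2" using assms by (simp add: cayley_def power2_eq_square field_simps)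
    then show ?thesis by (simp add: divide_divide_eq_left)
  qed
  ultimately show ?thesis by simp
qed

lemma weight_gf_0: "weight_gf l 0 q u = (if q = 0 then 1 else 0)"
proof -
  have "(\<Sum>n. weight_coeff l 0 q n * (u ^ 2) ^ n) = (\<Sum>n\<in>{0}. weight_coeff l 0 q n * (u ^ 2) ^ n)"
    by (rule suminf_finite) auto
  then show ?thesis by (simp add: weight_gf_def)
qed

lemma chain_0: "chain l 0 q t = cayley_log t ^ q / fact q"
proof -
  have "chain l 0 q t = (\<Sum>b\<in>{q}. cayley_log t ^ b / fact b * weight_gf l 0 (q - b) (cayley t))"
    unfolding chain_def by (rule sum.mono_neutral_right) (auto simp: weight_gf_0)
  then show ?thesis by (simp add: weight_gf_0)
qed

text \<open>
  The two contributions that lower \<open>q\<close>, one from the logarithm and one from the generating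
  function, cancel. The kernel \<open>2 \<epsilon> du / (1 - \<epsilon> u\<^sup>2)\<close> in \<open>u\<close> becomes \<open>- dt / t\<close> for
  \<open>\<epsilon> = 1\<close> and \<open>2 dt / (1 + t\<^sup>2)\<close> for \<open>\<epsilon> = - 1\<close>.
\<close>

lemma chain_deriv:
  assumes t: "0 < t" "t < 1"
  shows "(chain l (Suc i) q has_real_derivative (chain_kernel l i t * chain l i q t)) (at t)"
proof -
  define u where "u = cayley t"
  have u: "0 < u" "u < 1" using cayley_bounds[OF t] by (auto simp: u_def)
  define c where "c = 2 * twist l i / (1 - twist l i * u ^ 2)"
  define P where "P b = (- ln u) ^ b / fact b" for b
  define P' where "P' b = (if b = 0 then 0 else P (b - 1))" for b
  define G where "G b = weight_gf l (Suc i) b u" for b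
  define G' where "G' b = (if b = 0 then 0 else G (b - 1))" for b
  have dP: "((\<lambda>u. (- ln u) ^ b / fact b) has_real_derivative (- P' b / u)) (at u)" for b
    using DERIV_divided_power[OF DERIV_minus[OF DERIV_ln_divide[OF u(1)]], of b]
    by (cases b) (simp_all add: P'_def P_def)
  have dG: "(weight_gf l (Suc i) b has_real_derivative (G' b / u + c * weight_gf l i b u)) (at u)" for b
    using weight_gf_deriv[OF u, of l i b] by (simp only: G'_def G_def c_def)
  have "((\<lambda>u. \<Sum>b\<le>q. (- ln u) ^ b / fact b * weight_gf l (Suc i) (q - b) u) has_real_derivative
      (\<Sum>b\<le>q. (- P' b / u) * G (q - b) + (G' (q - b) / u + c * weight_gf l i (q - b) u) * P b)) (at u)"
    unfolding P_def G_def
    by (intro DERIV_sum DERIV_mult dP dG[unfolded P_def G_def])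
  moreover have "(\<Sum>b\<le>q. (- P' b / u) * G (q - b) + (G' (q - b) / u + c * weight_gf l i (q - b) u) * P b) =
      c * (\<Sum>b\<le>q. P b * weight_gf l i (q - b) u)"
  proof -
    have "(\<Sum>b\<le>q. P' b * G (q - b)) = (\<Sum>b\<le>q. P b * G' (q - b))"
    proof (cases q)
      case (Suc p)
      have "(\<Sum>b\<le>Suc p. P' b * G (Suc p - b)) = (\<Sum>b\<le>p. P b * G (p - b))"
        by (subst sum.atMost_Suc_shift) (simp add: P'_def)
      moreover have "(\<Sum>b\<le>Suc p. P b * G' (Suc p - b)) = (\<Sum>b\<le>p. P b * G (p - b))"
        by (simp add: G'_def Suc_diff_le)
      ultimately show ?thesis by (simp add: Suc)
    qed (simp add: P'_def G'_def)
    moreover have "(\<Sum>b\<le>q. (- P' b / u) * G (q - b) + (G' (q - b) / u + c * weight_gf l i (q - b) u) * P b) =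
      (\<Sum>b\<le>q. c * (P b * weight_gf l i (q - b) u)) + ((\<Sum>b\<le>q. P b * G' (q - b)) - (\<Sum>b\<le>q. P' b * G (q - b))) / u"
      unfolding sum_subtractf[symmetric] sum_divide_distrib sum.distrib[symmetric]
      using u by (intro sum.cong) (auto simp: field_simps)
    ultimately show ?thesis by (simp add: sum_distrib_left)
  qed
  ultimately have du: "((\<lambda>u. \<Sum>b\<le>q. (- ln u) ^ b / fact b * weight_gf l (Suc i) (q - b) u) has_real_derivative
      c * (\<Sum>b\<le>q. P b * weight_gf l i (q - b) u)) (at u)" by simp
  have "((\<lambda>t. \<Sum>b\<le>q. (- ln (cayley t)) ^ b / fact b * weight_gf l (Suc i) (q - b) (cayley t)) has_real_derivative
      (c * (\<Sum>b\<le>q. P b * weight_gf l i (q - b) u)) * (- 2 / (1 + t) ^ 2)) (at t)"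
    by (rule DERIV_chain2[where g = cayley]) (use du cayley_deriv t in \<open>auto simp: u_def\<close>)
  then have "(chain l (Suc i) q has_real_derivative (c * (- 2 / (1 + t) ^ 2)) * chain l i q t) (at t)"
    by (simp add: chain_def[abs_def] cayley_log_def P_def u_def mult_ac)
  moreover have "c * (- 2 / (1 + t) ^ 2) = chain_kernel l i t"
  proof -
    have ut: "u * (1 + t) = 1 - t" using t by (simp add: u_def cayley_def)
    have "(1 - u ^ 2) * (1 + t) ^ 2 = (1 + t) ^ 2 - (u * (1 + t)) ^ 2"
      "(1 + u ^ 2) * (1 + t) ^ 2 = (1 + t) ^ 2 + (u * (1 + t)) ^ 2"
      unfolding power_mult_distrib by (simp_all add: left_diff_distrib distrib_right)
    then have "(1 - u ^ 2) * (1 + t) ^ 2 = 4 * t" "(1 + u ^ 2) * (1 + t) ^ 2 = 2 * (1 + t ^ 2)"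
      unfolding ut by (simp_all add: power2_eq_square algebra_simps)
    moreover have "4 / (2 * x) = 2 / x" for x :: real by simp
    moreover have "c * (- 2 / (1 + t) ^ 2) = - 4 * twist l i / ((1 - twist l i * u ^ 2) * (1 + t) ^ 2)"
      by (simp add: c_def)
    ultimately show ?thesis
      by (cases "i < l") (simp_all add: chain_kernel_def twist_def del: distrib_left_numeral)
  qed
  ultimately show ?thesis by (simp only:)
qed


lemma eventually_at_right_0_unit: "(\<And>t::real. 0 < t \<Longrightarrow> t < 1 \<Longrightarrow> P t) \<Longrightarrow> eventually P (at_right 0)"
  by (auto simp: eventually_at dist_real_def intro!: exI[of _ 1])

lemma filterlim_cayley_at_left_1: "filterlim cayley (at_right 0) (at_left 1)"
proof (rule tendsto_imp_filterlim_at_right)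
  have "((\<lambda>t::real. (1 - t) / (1 + t)) \<longlongrightarrow> (1 - 1) / (1 + 1)) (at_left 1)"
    by (intro tendsto_intros) auto
  then show "(cayley \<longlongrightarrow> 0) (at_left 1)" by (simp add: cayley_def[abs_def])
  show "eventually (\<lambda>t. cayley t > 0) (at_left 1)"
    by (rule eventually_at_left_1) (use cayley_bounds in auto)
qed

lemma filterlim_cayley_at_right_0: "filterlim cayley (at_left 1) (at_right 0)"
proof (rule tendsto_imp_filterlim_at_left)
  have "((\<lambda>t::real. (1 - t) / (1 + t)) \<longlongrightarrow> (1 - 0) / (1 + 0)) (at_right 0)"
    by (intro tendsto_intros) auto
  then show "(cayley \<longlongrightarrow> 1) (at_right 0)" by (simp add: cayley_def[abs_def])
  show "eventually (\<lambda>t. cayley t < 1) (at_right 0)"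
    by (rule eventually_at_right_0_unit) (use cayley_bounds in auto)
qed

lemma cayley_tendsto_0: "(cayley \<longlongrightarrow> 0) (at_left 1)"
  using filterlim_cayley_at_left_1 by (simp add: filterlim_at)

lemma cayley_tendsto_1: "(cayley \<longlongrightarrow> 1) (at_right 0)"
  using filterlim_cayley_at_right_0 by (simp add: filterlim_at)

lemma cayley_log_tendsto_0: "(cayley_log \<longlongrightarrow> 0) (at_right 0)"
  unfolding cayley_log_def[abs_def]
  by (rule tendsto_eq_intros cayley_tendsto_1 refl | simp)+

lemma filterlim_cayley_log_at_left_1: "filterlim cayley_log at_top (at_left 1)"
  unfolding cayley_log_def[abs_def] filterlim_uminus_at_top[symmetric] minus_minus
  using filterlim_compose[OF ln_at_0 filterlim_cayley_at_left_1] by (simp add: filterlim_uminus_at_bot)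

lemma cayley_log_pos: "0 < t \<Longrightarrow> t < 1 \<Longrightarrow> 0 < cayley_log t"
  using cayley_bounds[of t] by (simp add: cayley_log_def)

lemma exp_cayley_log: "0 < t \<Longrightarrow> t < 1 \<Longrightarrow> exp (cayley_log t) = 1 / cayley t"
  using cayley_bounds[of t] by (simp add: cayley_log_def exp_minus inverse_eq_divide)

lemma cayley_log_power_mult_cayley: "((\<lambda>t. cayley_log t ^ b * cayley t) \<longlongrightarrow> 0) (at_left 1)"
proof -
  have "((\<lambda>t. cayley_log t ^ b / exp (cayley_log t)) \<longlongrightarrow> 0) (at_left 1)"
    by (rule filterlim_compose[OF tendsto_power_div_exp_0 filterlim_cayley_log_at_left_1])
  moreover have "eventually (\<lambda>t. cayley_log t ^ b / exp (cayley_log t) = cayley_log t ^ b * cayley t) (at_left 1)"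
    by (rule eventually_at_left_1) (simp add: exp_cayley_log)
  ultimately show ?thesis by (rule Lim_transform_eventually)
qed

lemma chain_tendsto_at_left_1: "(chain l (Suc i) q \<longlongrightarrow> 0) (at_left 1)"
proof -
  have "((\<lambda>t. cayley_log t ^ b / fact b * weight_gf l (Suc i) (q - b) (cayley t)) \<longlongrightarrow> 0) (at_left 1)" for b
  proof -
    have "isCont (\<lambda>z. \<Sum>n. weight_coeff l (Suc i) (q - b) n * z ^ n) 0"
      by (rule isCont_powser[of _ "1 / 2"]) (use summable_weight_coeff_powser in auto)
    moreover have "((\<lambda>t. cayley t ^ 2) \<longlongrightarrow> 0) (at_left 1)"
      using tendsto_power[OF cayley_tendsto_0, of 2] by simp
    ultimately have "((\<lambda>t. \<Sum>n. weight_coeff l (Suc i) (q - b) n * (cayley t ^ 2) ^ n) \<longlongrightarrow>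
        (\<Sum>n. weight_coeff l (Suc i) (q - b) n * 0 ^ n)) (at_left 1)"
      by (rule isCont_tendsto_compose)
    then have "((\<lambda>t. (cayley_log t ^ b * cayley t) / fact b * (cayley t ^ i *
        (\<Sum>n. weight_coeff l (Suc i) (q - b) n * (cayley t ^ 2) ^ n))) \<longlongrightarrow>
        0 / fact b * (0 ^ i * (\<Sum>n. weight_coeff l (Suc i) (q - b) n * 0 ^ n))) (at_left 1)"
      by (intro tendsto_mult tendsto_divide tendsto_power tendsto_const cayley_log_power_mult_cayley cayley_tendsto_0) auto
    then show ?thesis by (simp add: weight_gf_def mult_ac)
  qed
  from tendsto_sum[of "{..q}", OF this]
  show ?thesis by (simp add: chain_def[abs_def])
qed

lemma filterlim_cayley_square: "filterlim (\<lambda>t. cayley t ^ 2) (at_left 1) (at_right 0)"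
proof (rule tendsto_imp_filterlim_at_left)
  show "((\<lambda>t. cayley t ^ 2) \<longlongrightarrow> 1) (at_right 0)"
    using tendsto_power[OF cayley_tendsto_1, of 2] by simp
  show "eventually (\<lambda>t. cayley t ^ 2 < 1) (at_right 0)"
    by (rule eventually_at_right_0_unit) (use cayley_bounds in \<open>auto simp: power_less_one_iff less_imp_le\<close>)
qed

text \<open>
  For \<open>u\<close> the Cayley transform of \<open>t\<close>, one has \<open>1 - u\<^sup>2 = t (1 + u)\<^sup>2\<close>, so that
  \<open>powser_null_coeffs_at_1\<close> applies to the power series in \<open>u\<^sup>2\<close>.
\<close>

lemma chain_times_id_tendsto: "((\<lambda>t. t * chain l i q t) \<longlongrightarrow> 0) (at_right 0)"
proof -
  have "((\<lambda>t. t * (cayley_log t ^ b / fact b * weight_gf l i (q - b) (cayley t))) \<longlongrightarrow> 0) (at_right 0)" for b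
  proof -
    have "((\<lambda>t. (1 - cayley t ^ 2) * (\<Sum>n. weight_coeff l i (q - b) n * (cayley t ^ 2) ^ n)) \<longlongrightarrow> 0) (at_right 0)"
      by (rule filterlim_compose[OF powser_null_coeffs_at_1[OF weight_coeff_null] filterlim_cayley_square])
    then have "((\<lambda>t. ((1 - cayley t ^ 2) * (\<Sum>n. weight_coeff l i (q - b) n * (cayley t ^ 2) ^ n))
        * (cayley_log t ^ b / fact b) * cayley t ^ i / (1 + cayley t) ^ 2) \<longlongrightarrow>
        0 * (0 ^ b / fact b) * 1 ^ i / (1 + 1) ^ 2) (at_right 0)"
      by (intro tendsto_intros cayley_tendsto_1 cayley_log_tendsto_0) auto
    moreover have "eventually (\<lambda>t. ((1 - cayley t ^ 2) * (\<Sum>n. weight_coeff l i (q - b) n * (cayley t ^ 2) ^ n))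
        * (cayley_log t ^ b / fact b) * cayley t ^ i / (1 + cayley t) ^ 2 =
        t * (cayley_log t ^ b / fact b * weight_gf l i (q - b) (cayley t))) (at_right 0)"
    proof (rule eventually_at_right_0_unit)
      fix t :: real assume t: "0 < t" "t < 1"
      have "1 - cayley t ^ 2 = t * (1 + cayley t) ^ 2"
        using t by (simp add: cayley_def power_divide field_simps) (simp add: power2_eq_square algebra_simps)
      moreover have "1 + cayley t \<noteq> 0" using cayley_bounds[OF t] by auto
      ultimately show "((1 - cayley t ^ 2) * (\<Sum>n. weight_coeff l i (q - b) n * (cayley t ^ 2) ^ n))
        * (cayley_log t ^ b / fact b) * cayley t ^ i / (1 + cayley t) ^ 2 =
        t * (cayley_log t ^ b / fact b * weight_gf l i (q - b) (cayley t))"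
        by (simp add: weight_gf_def)
    qed
    ultimately show ?thesis by (auto intro: Lim_transform_eventually)
  qed
  from tendsto_sum[of "{..q}", OF this]
  show ?thesis by (simp add: chain_def sum_distrib_left)
qed

lemma chain_tendsto_W:
  assumes l: "l < r"
  shows "(chain l r q \<longlongrightarrow> W l (q + r) r) (at_right 0)"
proof -
  have "((\<lambda>t. cayley_log t ^ b / fact b * weight_gf l r (q - b) (cayley t)) \<longlongrightarrow>
    0 ^ b / fact b * (1 ^ r * suminf (weight_coeff l r (q - b)))) (at_right 0)" for b
  proof -
    have "((\<lambda>t. \<Sum>n. weight_coeff l r (q - b) n * (cayley t ^ 2) ^ n) \<longlongrightarrow> suminf (weight_coeff l r (q - b))) (at_right 0)"
      by (rule filterlim_compose[OF abel_limit[OF W_eq_suminf_weight_coeff(1)[OF l]] filterlim_cayley_square])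
    then show ?thesis unfolding weight_gf_def
      by (intro tendsto_intros cayley_tendsto_1 cayley_log_tendsto_0) auto
  qed
  from tendsto_sum[of "{..q}", OF this]
  have "(chain l r q \<longlongrightarrow> (\<Sum>b\<le>q. 0 ^ b / fact b * (1 ^ r * suminf (weight_coeff l r (q - b))))) (at_right 0)"
    by (simp add: chain_def[abs_def])
  also have "(\<Sum>b\<le>q. 0 ^ b / fact b * (1 ^ r * suminf (weight_coeff l r (q - b)))) =
     (\<Sum>b\<in>{0}. 0 ^ b / fact b * (1 ^ r * suminf (weight_coeff l r (q - b))))"
    by (rule sum.mono_neutral_right) auto
  finally show ?thesis using W_eq_suminf_weight_coeff(2)[OF l] by simp
qed

lemma weight_coeff_nonneg: "i \<le> l \<Longrightarrow> weight_coeff l i q n \<ge> 0"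
proof (induction i arbitrary: q n)
  case (Suc i)
  then show ?case unfolding weight_coeff.simps
    by (intro sum_nonneg mult_nonneg_nonneg) (auto simp: twist_def)
qed auto

lemma chain_nonneg:
  assumes "i \<le> l" "0 < t" "t < 1"
  shows "chain l i q t \<ge> 0"
proof -
  have c: "0 < cayley t" "cayley t < 1" using cayley_bounds assms by auto
  then have "cayley t ^ 2 < 1" by (simp add: power_less_one_iff)
  then have "weight_gf l i b (cayley t) \<ge> 0" for b
    unfolding weight_gf_def using c weight_coeff_nonneg[OF assms(1)]
    by (intro mult_nonneg_nonneg suminf_nonneg summable_weight_coeff_powser) auto
  then show ?thesis
    unfolding chain_def using cayley_log_pos[OF assms(2,3)] by (intro sum_nonneg mult_nonneg_nonneg) auto
qed

section \<open>Powers of the arctangent and logarithmic moments\<close>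

text \<open>
  The Taylor coefficients of \<open>(2 arctan t)\<^sup>i / i!\<close>; the recursion is the differential equation
  \<open>(1 + t\<^sup>2) f\<^sub>i' = 2 f\<^bsub>i-1\<^esub>\<close> read off at each power of \<open>t\<close>.
\<close>

fun arctan_coeff :: "nat \<Rightarrow> nat \<Rightarrow> real" where
  "arctan_coeff 0 n = (if n = 0 then 1 else 0)"
| "arctan_coeff (Suc i) 0 = 0"
| "arctan_coeff (Suc i) (Suc 0) = 2 * arctan_coeff i 0"
| "arctan_coeff (Suc i) (Suc (Suc n)) =
     (2 * arctan_coeff i (Suc n) - real n * arctan_coeff (Suc i) n) / real (n + 2)"

definition arctan_power :: "nat \<Rightarrow> real \<Rightarrow> real" where
  "arctan_power i t = (2 * arctan t) ^ i / fact i"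

lemma arctan_coeff_bound: "\<bar>arctan_coeff i n\<bar> \<le> 2 ^ i"
proof (induction i n rule: arctan_coeff.induct)
  case (4 i n)
  have "\<bar>2 * arctan_coeff i (Suc n) - real n * arctan_coeff (Suc i) n\<bar> \<le>
      2 * \<bar>arctan_coeff i (Suc n)\<bar> + real n * \<bar>arctan_coeff (Suc i) n\<bar>"
    by (rule order.trans[OF abs_triangle_ineq4]) (simp add: abs_mult)
  also have "\<dots> \<le> 2 * 2 ^ i + real n * 2 ^ Suc i"
    using 4 by (intro add_mono mult_left_mono) auto
  also have "\<dots> \<le> 2 ^ Suc i * real (n + 2)" by (simp add: algebra_simps)
  finally show ?case by (simp add: divide_le_eq)
qed auto

lemma arctan_coeff_parity: "odd (i + n) \<Longrightarrow> arctan_coeff i n = 0"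
  by (induction i n rule: arctan_coeff.induct) (auto elim: oddE)

lemma arctan_power_deriv:
  "(arctan_power (Suc i) has_real_derivative (2 / (1 + t ^ 2) * arctan_power i t)) (at t)"
proof -
  have "((\<lambda>t. 2 * arctan t) has_real_derivative 2 / (1 + t ^ 2)) (at t)"
    by (auto intro!: derivative_eq_intros simp: inverse_eq_divide)
  from DERIV_divided_power[OF this, of "Suc i"] show ?thesis
    by (simp only: arctan_power_def[abs_def] nat.distinct if_False diff_Suc_1 mult.commute)
qed

lemma arctan_power_sums: "\<bar>t\<bar> < 1 \<Longrightarrow> (\<lambda>n. arctan_coeff i n * t ^ n) sums arctan_power i t"
proof (induction i arbitrary: t)
  case 0
  have "(\<lambda>n. arctan_coeff 0 n * t ^ n) sums (\<Sum>n\<in>{0}. arctan_coeff 0 n * t ^ n)"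
    by (rule sums_finite) auto
  then show ?case by (simp add: arctan_power_def)
next
  case (Suc i)
  define c where "c = arctan_coeff (Suc i)"
  define F where "F t = (\<Sum>n. c n * t ^ n)" for t
  have sc: "summable (\<lambda>n. c n * t ^ n)" if "\<bar>t\<bar> < 1" for t
    unfolding c_def using arctan_coeff_bound that by (rule summable_bounded_powser)
  have dF: "(F has_real_derivative (2 / (1 + t ^ 2) * arctan_power i t)) (at t)" if t: "\<bar>t\<bar> < 1" for t
  proof -
    define F' where "F' = (\<Sum>n. diffs c n * t ^ n)"
    have "(F has_real_derivative F') (at t)"
      unfolding F_def[abs_def] F'_def by (rule termdiffs_strong'[where K = 1]) (use sc t in auto)
    moreover have "F' = 2 / (1 + t ^ 2) * arctan_power i t"
    proof -
      have "summable (\<lambda>n. diffs c n * t ^ n)"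
        by (rule termdiff_converges[where K = 1]) (use sc t in auto)
      then have s: "(\<lambda>n. diffs c n * t ^ n) sums F'" unfolding F'_def by (rule summable_sums)
      have sums1: "(\<lambda>n. diffs c (n + 2) * t ^ (n + 2) + t ^ 2 * (diffs c n * t ^ n)) sums
          (F' - (\<Sum>n<2. diffs c n * t ^ n) + t ^ 2 * F')"
        by (intro sums_add sums_mult sums_split_initial_segment s)
      have sums2: "(\<lambda>n. 2 * (arctan_coeff i (n + 2) * t ^ (n + 2))) sums
          (2 * (arctan_power i t - (\<Sum>n<2. arctan_coeff i n * t ^ n)))"
        by (intro sums_mult sums_split_initial_segment Suc.IH t)
      have eq: "diffs c (n + 2) * t ^ (n + 2) + t ^ 2 * (diffs c n * t ^ n) =
          2 * (arctan_coeff i (n + 2) * t ^ (n + 2))" for n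
      proof -
        have "diffs c (n + 2) + diffs c n = 2 * arctan_coeff i (n + 2)"
          unfolding c_def diffs_def by (simp add: field_simps)
        moreover have "diffs c (n + 2) * t ^ (n + 2) + t ^ 2 * (diffs c n * t ^ n) =
          (diffs c (n + 2) + diffs c n) * t ^ (n + 2)"
          by (simp add: power_add power2_eq_square algebra_simps)
        ultimately show ?thesis by simp
      qed
      have "F' - (\<Sum>n<2. diffs c n * t ^ n) + t ^ 2 * F' =
          2 * (arctan_power i t - (\<Sum>n<2. arctan_coeff i n * t ^ n))"
        using sums1 unfolding eq by (rule sums_unique2[OF _ sums2])
      moreover have "(\<Sum>n<2. diffs c n * t ^ n) = 2 * (\<Sum>n<2. arctan_coeff i n * t ^ n)"
        by (simp add: numeral_2_eq_2 diffs_def c_def)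
      ultimately have "(1 + t ^ 2) * F' = 2 * arctan_power i t" by (simp add: algebra_simps)
      moreover have "1 + t ^ 2 \<noteq> 0" by (metis add_pos_nonneg less_irrefl zero_le_power2 zero_less_one)
      ultimately show ?thesis by (simp add: field_simps)
    qed
    ultimately show ?thesis by simp
  qed
  have "\<exists>k. \<forall>t\<in>{-1<..<1}. F t - arctan_power (Suc i) t = k"
  proof (rule has_field_derivative_zero_constant)
    fix t :: real assume t: "t \<in> {-1<..<1}"
    have "((\<lambda>t. F t - arctan_power (Suc i) t) has_real_derivative
        (2 / (1 + t ^ 2) * arctan_power i t - 2 / (1 + t ^ 2) * arctan_power i t)) (at t)"
      by (intro DERIV_diff dF arctan_power_deriv) (use t in auto)
    then show "((\<lambda>t. F t - arctan_power (Suc i) t) has_real_derivative 0) (at t within {-1<..<1})"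
      by (simp add: has_field_derivative_at_within)
  qed auto
  then obtain k where k: "\<And>t. \<bar>t\<bar> < 1 \<Longrightarrow> F t - arctan_power (Suc i) t = k"
    by (force simp: abs_less_iff)
  have "k = 0" using k[of 0] by (simp add: F_def c_def arctan_power_def)
  then have "F t = arctan_power (Suc i) t" using k[OF Suc.prems] by simp
  then show ?case using summable_sums[OF sc[OF Suc.prems]] by (simp add: F_def c_def)
qed

lemma cayley_log_nonneg: "0 \<le> t \<Longrightarrow> t \<le> 1 \<Longrightarrow> 0 \<le> cayley_log t"
  using cayley_log_pos[of t] by (cases "t = 0"; cases "t = 1") (auto simp: cayley_log_def cayley_def)

lemma power_div_fact_le_exp:
  assumes "(x::real) \<ge> 0" shows "x ^ n / fact n \<le> exp x"
proof -
  have s: "summable (\<lambda>n. x ^ n / fact n)" using summable_exp[of x] by (simp add: divide_inverse mult.commute)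
  have "(\<Sum>k\<in>{n}. x ^ k / fact k) \<le> (\<Sum>k. x ^ k / fact k)"
    by (rule sum_le_suminf[OF s]) (use assms in auto)
  also have "\<dots> = exp x" by (simp add: exp_def divide_inverse mult.commute)
  finally show ?thesis by simp
qed

text \<open>
  With \<open>x = (1 + t) / 2\<close> the function \<open>exp (y L)\<close> is \<open>(x / (1 - x))\<^sup>y\<close> on the right half of the unit
  interval, and \<open>exp (- y L)\<close> is the same function on the left half. Together they give the
  Beta integral \<open>B(1 + y, 1 - y) = y \<Gamma>(y) \<Gamma>(1 - y)\<close>, evaluated by the reflection formula.
\<close>

lemma has_integral_cosh_cayley_log:
  assumes y: "0 < y" "y < 1"
  shows "(\<lambda>t. exp (y * cayley_log t)) integrable_on {0..1}"
    and "((\<lambda>t. cosh (y * cayley_log t)) has_integral (pi * y / sin (pi * y))) {0..1}"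
proof -
  define f where "f s = s powr y * (1 - s) powr (- y)" for s :: real
  have B: "(f has_integral Beta (1 + y) (1 - y)) {0..1}"
    using has_integral_Beta_real[of "1 + y" "1 - y"] y by (simp add: f_def[abs_def])
  have int: "f integrable_on {0..1/2}" "f integrable_on {1/2..1}"
    by (rule integrable_on_subinterval[OF has_integral_integrable[OF B]], force)+
  define i1 i2 where "i1 = integral {1/2..1} f" and "i2 = integral {0..1/2} f"
  have i12: "i2 + i1 = Beta (1 + y) (1 - y)"
    unfolding i1_def i2_def using Henstock_Kurzweil_Integration.integral_combine[of 0 "1/2" 1 f] B
    by (auto simp: has_integral_iff)
  have "((\<lambda>t. f (1/2 * t + 1/2)) has_integral (2 * i1)) ((\<lambda>x. 2 * x + - 1) ` {1/2..1})"
    using has_integral_affinity[of f i1 "1/2" 1 "1/2" "1/2"] int(2) by (auto simp: i1_def has_integral_iff)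
  moreover have "(\<lambda>x::real. 2 * x + - 1) ` {1/2..1} = {0..1}"
    using image_affinity_atLeastAtMost[of "2::real" "-1" "1/2" 1] by simp
  ultimately have 1: "((\<lambda>t. f (1/2 * t + 1/2)) has_integral (2 * i1)) {0..1}" by simp
  have "((\<lambda>t. f (- (1/2) * t + 1/2)) has_integral (2 * i2)) ((\<lambda>x. - 2 * x + 1) ` {0..1/2})"
    using has_integral_affinity[of f i2 0 "1/2" "- (1/2)" "1/2"] int(1) by (auto simp: i2_def has_integral_iff)
  moreover have "(\<lambda>x::real. - 2 * x + 1) ` {0..1/2} = {0..1}"
    using image_affinity_atLeastAtMost[of "- 2::real" 1 0 "1/2"] by simp
  ultimately have 2: "((\<lambda>t. f (- (1/2) * t + 1/2)) has_integral (2 * i2)) {0..1}" by simp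
  have f1: "f (1/2 * t + 1/2) = exp (y * cayley_log t)" and f2: "f (- (1/2) * t + 1/2) = exp (- (y * cayley_log t))"
    if t: "t \<in> {0..1} - {1}" for t
  proof -
    define a b where "a = ln (1/2 * t + 1/2)" and "b = ln (- (1/2) * t + 1/2)"
    have "b - a = ln ((- (1/2) * t + 1/2) / (1/2 * t + 1/2))"
      unfolding a_def b_def using t by (subst ln_div) auto
    also have "(- (1/2) * t + 1/2) / (1/2 * t + 1/2) = cayley t"
      using t by (simp add: cayley_def field_simps)
    finally have L: "cayley_log t = a - b" by (simp add: cayley_log_def)
    have p: "1 - (1/2 * t + 1/2) = - (1/2) * t + 1/2" "1 - (- (1/2) * t + 1/2) = 1/2 * t + 1/2" by simp_all
    have n: "1/2 * t + 1/2 \<noteq> 0" "- (1/2) * t + 1/2 \<noteq> 0" using t by auto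
    have "f (1/2 * t + 1/2) = exp (y * a) * exp (- y * b)" "f (- (1/2) * t + 1/2) = exp (y * b) * exp (- y * a)"
      unfolding f_def p powr_def a_def b_def using n by (simp_all only: if_False)
    then show "f (1/2 * t + 1/2) = exp (y * cayley_log t)" "f (- (1/2) * t + 1/2) = exp (- (y * cayley_log t))"
      by (simp_all only: L exp_add[symmetric]) (simp_all add: algebra_simps)
  qed
  have e1: "((\<lambda>t. exp (y * cayley_log t)) has_integral (2 * i1)) {0..1}"
    by (rule has_integral_spike_finite[OF _ _ 1, of "{1}"]) (use f1 in auto)
  have e2: "((\<lambda>t. exp (- (y * cayley_log t))) has_integral (2 * i2)) {0..1}"
    by (rule has_integral_spike_finite[OF _ _ 2, of "{1}"]) (use f2 in auto)
  show "(\<lambda>t. exp (y * cayley_log t)) integrable_on {0..1}" using e1 by (rule has_integral_integrable)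
  have "(2 * i1 + 2 * i2) / 2 = Beta (1 + y) (1 - y)" using i12 by simp
  then have "((\<lambda>t. (exp (y * cayley_log t) + exp (- (y * cayley_log t))) / 2) has_integral Beta (1 + y) (1 - y)) {0..1}"
    using has_integral_divide[OF has_integral_add[OF e1 e2], of 2] by (simp only:)
  then have c: "((\<lambda>t. cosh (y * cayley_log t)) has_integral (Beta (1 + y) (1 - y))) {0..1}"
    by (simp only: cosh_field_def)
  have of_real: "1 - complex_of_real y = complex_of_real (1 - y)" "of_real pi * complex_of_real y = of_real (pi * y)"
    by simp_all
  have "complex_of_real (Gamma y * Gamma (1 - y)) = complex_of_real (pi / sin (pi * y))"
    using Gamma_reflection_complex[of "complex_of_real y"]
    unfolding of_real Gamma_complex_of_real sin_of_real by (simp only: of_real_mult of_real_divide)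
  then have "Gamma y * Gamma (1 - y) = pi / sin (pi * y)" by (simp only: of_real_eq_iff)
  moreover have "Gamma (1 + y) = y * Gamma y"
    using Gamma_plus1[of y] y nonpos_Ints_nonpos[of y] by (force simp: add.commute)
  moreover have "Gamma (2::real) = 1" using Gamma_numeral[of "num.Bit0 num.One", where 'a = real] by simp
  ultimately have "Beta (1 + y) (1 - y) = pi * y / sin (pi * y)" by (simp add: Beta_def mult.assoc)
  with c show "((\<lambda>t. cosh (y * cayley_log t)) has_integral (pi * y / sin (pi * y))) {0..1}" by simp
qed

text \<open>
  For \<open>n = 0\<close> the exponent is cut off at \<open>0\<close>; this value only ever occurs with a factor \<open>n\<close>.
\<close>

definition log_moment :: "nat \<Rightarrow> nat \<Rightarrow> real" where
  "log_moment q n = integral {0..1} (\<lambda>t. cayley_log t ^ q / fact q * t ^ (n - 1))"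

lemma has_integral_log_moment:
  "((\<lambda>t. cayley_log t ^ q / fact q * t ^ (n - 1)) has_integral log_moment q n) {0..1}"
  unfolding log_moment_def
proof (rule integrable_integral, rule measurable_bounded_by_integrable_imp_integrable_real)
  have "(\<lambda>t. cayley_log t ^ q / fact q * t ^ (n - 1)) \<in> borel_measurable borel"
    unfolding cayley_log_def cayley_def by measurable
  then show "(\<lambda>t. cayley_log t ^ q / fact q * t ^ (n - 1)) \<in> borel_measurable (lebesgue_on {0..1})"
    by (intro measurable_restrict_space1 measurable_completion) simp
  \<comment> \<open>The exponent \<open>1 / 2\<close> is an arbitrary choice in \<open>{0<..<1}\<close>, where the exponential is integrable.\<close>
  show "(\<lambda>t. 2 ^ q * exp (1 / 2 * cayley_log t)) integrable_on {0..1}"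
    using integrable_cmul[OF has_integral_cosh_cayley_log(1)[of "1 / 2"], of "2 ^ q"] by simp
  fix t :: real assume t: "t \<in> {0..1}"
  have L: "cayley_log t \<ge> 0" using t cayley_log_nonneg by auto
  have "\<bar>cayley_log t ^ q / fact q * t ^ (n - 1)\<bar> \<le> cayley_log t ^ q / fact q * 1"
    using L t by (subst abs_of_nonneg) (auto intro!: mult_mono power_le_one simp del: times_divide_eq_left mult_1_right)
  also have "\<dots> = 2 ^ q * ((1 / 2 * cayley_log t) ^ q / fact q)" by (simp add: power_divide)
  also have "\<dots> \<le> 2 ^ q * exp (1 / 2 * cayley_log t)"
    using L by (intro mult_left_mono power_div_fact_le_exp) auto
  finally show "\<bar>cayley_log t ^ q / fact q * t ^ (n - 1)\<bar> \<le> 2 ^ q * exp (1 / 2 * cayley_log t)" .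
qed auto

text \<open>
  Integrate the derivative of \<open>L\<^sup>q / q! (1 - t\<^sup>2) t\<^sup>n\<close>, using \<open>L' = 2 / (1 - t\<^sup>2)\<close>. The boundary
  terms vanish except for \<open>n = q = 0\<close>.
\<close>

lemma log_moment_rec:
  assumes "n + q \<ge> 1"
  shows "real (n + 2) * log_moment q (n + 2) =
    real n * log_moment q n + 2 * (if q = 0 then 0 else log_moment (q - 1) (n + 1))"
proof -
  define P where "P q t = cayley_log t ^ q / fact q" for q t
  define P' where "P' t = (if q = 0 then 0 else P (q - 1) t)" for t
  let ?f = "\<lambda>t. P q t * ((1 - t ^ 2) * t ^ n)"
  let ?f' = "\<lambda>t. real n * (P q t * t ^ (n - 1)) + 2 * (P' t * t ^ (n + 1 - 1))
      - real (n + 2) * (P q t * t ^ (n + 2 - 1))"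
  have "(?f' has_integral (0 - 0)) {0..1}"
  proof (rule has_integral_from_limits)
    fix t :: real assume t: "0 < t" "t < 1"
    have n: "1 - t ^ 2 \<noteq> 0" using t by (simp add: power2_eq_1_iff)
    have "(P q has_real_derivative P' t * (2 / (1 - t ^ 2))) (at t)"
      unfolding P_def[abs_def] P'_def using DERIV_divided_power[OF cayley_log_deriv[OF t], of q] by simp
    moreover have "((\<lambda>t. (1 - t ^ 2) * t ^ n) has_real_derivative
        real n * t ^ (n - 1) - real (n + 2) * t ^ (n + 1)) (at t)"
    proof -
      have "((\<lambda>t. t ^ n - t ^ (n + 2)) has_real_derivative
        real n * t ^ (n - Suc 0) - real (n + 2) * t ^ (n + 2 - Suc 0)) (at t)"
        by (intro DERIV_diff DERIV_pow)
      moreover have "(\<lambda>t::real. (1 - t ^ 2) * t ^ n) = (\<lambda>t. t ^ n - t ^ (n + 2))"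
        by (simp add: fun_eq_iff algebra_simps power_add power2_eq_square)
      ultimately show ?thesis by simp
    qed
    ultimately have "(?f has_real_derivative (P' t * (2 / (1 - t ^ 2)) * ((1 - t ^ 2) * t ^ n)
        + (real n * t ^ (n - 1) - real (n + 2) * t ^ (n + 1)) * P q t)) (at t)"
      by (rule DERIV_mult)
    moreover have "P' t * (2 / (1 - t ^ 2)) * ((1 - t ^ 2) * t ^ n) = 2 * (P' t * t ^ n)"
      using n by simp
    ultimately show "(?f has_real_derivative ?f' t) (at t)" by (simp add: algebra_simps)
  next
    have "(?f \<longlongrightarrow> 0 ^ q / fact q * ((1 - 0 ^ 2) * 0 ^ n)) (at_right 0)"
      unfolding P_def by (intro tendsto_intros cayley_log_tendsto_0) auto
    then show "(?f \<longlongrightarrow> 0) (at_right 0)" using assms by (cases q; cases n) auto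
  next
    have "((\<lambda>t. (cayley_log t ^ q * cayley t) / fact q * ((1 + t) ^ 2 * t ^ n)) \<longlongrightarrow> 0 / fact q * ((1 + 1) ^ 2 * 1 ^ n)) (at_left 1)"
      by (intro tendsto_intros cayley_log_power_mult_cayley) auto
    moreover have "eventually (\<lambda>t. (cayley_log t ^ q * cayley t) / fact q * ((1 + t) ^ 2 * t ^ n) = ?f t) (at_left 1)"
    proof (rule eventually_at_left_1)
      fix t :: real assume t: "0 < t" "t < 1"
      have "cayley t * (1 + t) ^ 2 = 1 - t ^ 2" using t by (simp add: cayley_def power2_eq_square field_simps)
      then show "(cayley_log t ^ q * cayley t) / fact q * ((1 + t) ^ 2 * t ^ n) = ?f t"
        by (simp add: P_def flip: mult.assoc)
    qed
    ultimately show "(?f \<longlongrightarrow> 0) (at_left 1)" by (auto intro: Lim_transform_eventually)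
  qed auto
  moreover have "(?f' has_integral (real n * log_moment q n
      + 2 * (if q = 0 then 0 else log_moment (q - 1) (n + 1)) - real (n + 2) * log_moment q (n + 2))) {0..1}"
    unfolding P_def
    by (intro has_integral_add has_integral_diff has_integral_mult_right has_integral_log_moment)
      (auto simp: P'_def P_def intro: has_integral_log_moment[of _ "n + 1", simplified])
  ultimately have "0 - 0 = real n * log_moment q n
      + 2 * (if q = 0 then 0 else log_moment (q - 1) (n + 1)) - real (n + 2) * log_moment q (n + 2)"
    by (rule has_integral_unique)
  then show ?thesis by simp
qed


lemma log_moment_0_1: "log_moment 0 1 = 1"
  by (simp add: log_moment_def flip: One_nat_def)

lemma cosh_sums: "(\<lambda>j. x ^ (2 * j) / fact (2 * j)) sums cosh (x::real)"
proof -
  have "(\<lambda>n. if even n then x ^ n /\<^sub>R fact n else 0) sums cosh x" by (rule cosh_converges)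
  then have "(\<lambda>j. if even (2 * j) then x ^ (2 * j) /\<^sub>R fact (2 * j) else 0) sums cosh x"
    by (subst sums_mono_reindex[of "\<lambda>j. 2 * j"]) (auto simp: strict_mono_def elim!: evenE)
  then show ?thesis by (simp add: divide_inverse mult.commute)
qed

lemma log_moment_sums:
  assumes y: "0 < y" "y < 1"
  shows "(\<lambda>j. log_moment (2 * j) 1 * y ^ (2 * j)) sums (pi * y / sin (pi * y))"
proof -
  define f where "f N t = (\<Sum>j<N. (y * cayley_log t) ^ (2 * j) / fact (2 * j))" for N t
  have f: "(f N has_integral (\<Sum>j<N. log_moment (2 * j) 1 * y ^ (2 * j))) {0..1}" for N
  proof -
    have "((\<lambda>t. \<Sum>j<N. cayley_log t ^ (2 * j) / fact (2 * j) * t ^ (1 - 1) * y ^ (2 * j)) has_integral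
        (\<Sum>j<N. log_moment (2 * j) 1 * y ^ (2 * j))) {0..1}"
      by (intro has_integral_sum has_integral_mult_left has_integral_log_moment) auto
    then show ?thesis by (simp add: f_def[abs_def] power_mult_distrib mult.commute)
  qed
  have "(\<lambda>N. integral {0..1} (f N)) \<longlonglongrightarrow> integral {0..1} (\<lambda>t. cosh (y * cayley_log t))"
  proof (rule dominated_convergence(2))
    show "f N integrable_on {0..1}" for N using f by (rule has_integral_integrable)
    show "(\<lambda>t. cosh (y * cayley_log t)) integrable_on {0..1}"
      using has_integral_cosh_cayley_log(2)[OF y] by (rule has_integral_integrable)
    show "norm (f N t) \<le> cosh (y * cayley_log t)" for N t
    proof -
      have "f N t \<ge> 0" unfolding f_def by (intro sum_nonneg divide_nonneg_pos zero_le_even_power) auto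
      moreover have "f N t \<le> cosh (y * cayley_log t)"
        unfolding f_def sums_unique[OF cosh_sums]
        by (intro sum_le_suminf sums_summable[OF cosh_sums]) (auto intro!: divide_nonneg_pos zero_le_even_power)
      ultimately show ?thesis by simp
    qed
    show "(\<lambda>N. f N t) \<longlonglongrightarrow> cosh (y * cayley_log t)" for t
      using cosh_sums[of "y * cayley_log t"] by (simp add: sums_def f_def)
  qed
  then show ?thesis
    by (simp only: sums_def integral_unique[OF f] integral_unique[OF has_integral_cosh_cayley_log(2)[OF y]])
qed

lemma alpha_sums:
  assumes "y \<noteq> 0"
  shows "(\<lambda>n. \<alpha> n * y ^ (2 * n)) sums (sin (pi * y) / (pi * y))"
proof -
  have "(\<lambda>n. (- 1) ^ n / fact (2 * n + 1) * (pi * y) ^ (2 * n + 1) / (pi * y)) sums (sin (pi * y) / (pi * y))"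
    by (intro sums_divide sin_paired)
  moreover have "(- 1) ^ n / fact (2 * n + 1) * (pi * y) ^ (2 * n + 1) / (pi * y) = \<alpha> n * y ^ (2 * n)" for n
    using assms by (simp add: \<alpha>_def power_mult_distrib)
  ultimately show ?thesis by simp
qed

text \<open>
  Divide by \<open>y\<^bsup>N\<^esup>\<close>, where \<open>N\<close> is the least positive index with a nonzero coefficient, and let
  \<open>y\<close> tend to \<open>0\<close>. Only positive \<open>y\<close> are available because the Beta integral is evaluated there.
\<close>

lemma powser_constant_coeffs:
  fixes d :: "nat \<Rightarrow> real"
  assumes sums: "\<And>y. 0 < y \<Longrightarrow> y < 1 \<Longrightarrow> (\<lambda>p. d p * y ^ p) sums d 0" and p: "p \<noteq> 0"
  shows "d p = 0"
proof (rule ccontr)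
  assume dp: "d p \<noteq> 0"
  define a where "a p = (if p = 0 then 0 else d p)" for p
  have a: "(\<lambda>p. a p * y ^ p) sums 0" if y: "0 < y" "y < 1" for y
  proof -
    have "(\<lambda>p. d p * y ^ p - (if p = 0 then d 0 else 0)) sums (d 0 - d 0)"
      by (intro sums_diff sums y sums_single)
    moreover have "d p * y ^ p - (if p = 0 then d 0 else 0) = a p * y ^ p" for p by (simp add: a_def)
    ultimately show ?thesis by simp
  qed
  obtain N where N: "a N \<noteq> 0" "\<And>n. n < N \<Longrightarrow> a n = 0"
    using LeastI[of "\<lambda>n. a n \<noteq> 0" p] not_less_Least[of _ "\<lambda>n. a n \<noteq> 0"] dp p by (auto simp: a_def)
  define h where "h y = (\<Sum>n. a (n + N) * y ^ n)" for y
  have h: "(\<lambda>n. a (n + N) * y ^ n) sums 0" if y: "0 < y" "y < 1" for y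
  proof -
    have "(\<lambda>n. a (n + N) * y ^ (n + N)) sums (0 - (\<Sum>n<N. a n * y ^ n))"
      by (rule sums_split_initial_segment[OF a[OF y]])
    then have "(\<lambda>n. a (n + N) * y ^ (n + N) / y ^ N) sums (0 / y ^ N)"
      by (intro sums_divide) (simp add: N)
    then show ?thesis using y by (simp add: power_add)
  qed
  have "isCont h 0"
    unfolding h_def[abs_def] by (rule isCont_powser[OF sums_summable[OF h[of "1 / 2"]]]) auto
  then have "(h \<longlongrightarrow> a N) (at_right 0)"
    by (simp add: isCont_def h_def filterlim_at_split)
  moreover have "eventually (\<lambda>y. h y = 0) (at_right 0)"
    by (rule eventually_at_right_0_unit) (use sums_unique[OF h] in \<open>auto simp: h_def\<close>)
  ultimately have "((\<lambda>y. 0) \<longlongrightarrow> a N) (at_right (0::real))"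
    using tendsto_cong by fastforce
  then have "a N = 0" using tendsto_unique[OF _ _ tendsto_const] trivial_limit_at_right_real by blast
  with N(1) show False ..
qed

text \<open>
  The generating functions \<open>\<pi> y / sin (\<pi> y)\<close> of the moments and \<open>sin (\<pi> y) / (\<pi> y)\<close> of \<open>\<alpha>\<close> are
  reciprocal to each other. The values of \<open>\<alpha>\<close> enter the proof only through this identity.
\<close>

lemma alpha_log_moment_convolution:
  "(\<Sum>j\<le>p. \<alpha> (p - j) * log_moment (2 * j) 1) = (if p = 0 then 1 else 0)"
proof -
  define d where "d p = (\<Sum>j\<le>p. \<alpha> (p - j) * log_moment (2 * j) 1)" for p
  have d0: "d 0 = 1" using log_moment_0_1 by (simp add: d_def \<alpha>_def)
  have "d p = 0" if "p \<noteq> 0"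
  proof (rule powser_constant_coeffs[OF _ that])
    fix z :: real assume z: "0 < z" "z < 1"
    define y where "y = sqrt z"
    have y: "0 < y" "y < 1" "y ^ 2 = z" using z by (auto simp: y_def)
    have pw: "y ^ (2 * n) = z ^ n" for n using y(3) by (simp add: power_mult)
    have 1: "(\<lambda>j. log_moment (2 * j) 1 * z ^ j) sums (pi * y / sin (pi * y))"
      using log_moment_sums[OF y(1,2)] by (simp add: pw)
    have 2: "(\<lambda>n. \<alpha> n * z ^ n) sums (sin (pi * y) / (pi * y))"
      using alpha_sums[of y] y by (simp add: pw)
    have n1: "summable (\<lambda>j. norm (log_moment (2 * j) 1 * z ^ j))"
      unfolding real_norm_def
    proof (rule summable_rabs_comparison_test)
      show "\<exists>N. \<forall>n\<ge>N. \<bar>log_moment (2 * n) 1 * z ^ n\<bar> \<le> log_moment (2 * n) 1 * z ^ n"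
      proof (intro exI allI impI)
        fix n
        have "log_moment (2 * n) 1 \<ge> 0" unfolding log_moment_def
          by (rule integral_nonneg[OF has_integral_integrable[OF has_integral_log_moment]])
            (auto intro!: divide_nonneg_pos mult_nonneg_nonneg zero_le_even_power)
        then show "\<bar>log_moment (2 * n) 1 * z ^ n\<bar> \<le> log_moment (2 * n) 1 * z ^ n" using z by simp
      qed
    qed (rule sums_summable[OF 1])
    \<comment> \<open>Convergence at the larger point \<open>(1 + z) / 2\<close> gives absolute convergence at \<open>z\<close>.\<close>
    define y' where "y' = sqrt ((1 + z) / 2)"
    have y': "y' \<noteq> 0" "y' ^ 2 = (1 + z) / 2" using z by (auto simp: y'_def)
    have "summable (\<lambda>n. \<alpha> n * ((1 + z) / 2) ^ n)"
      using sums_summable[OF alpha_sums[OF y'(1)]] by (simp add: power_mult y'(2))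
    then have n2: "summable (\<lambda>n. norm (\<alpha> n * z ^ n))"
      by (rule powser_insidea) (use z in auto)
    have "(\<lambda>p. \<Sum>j\<le>p. log_moment (2 * j) 1 * z ^ j * (\<alpha> (p - j) * z ^ (p - j))) sums
       ((\<Sum>j. log_moment (2 * j) 1 * z ^ j) * (\<Sum>n. \<alpha> n * z ^ n))"
      by (rule Cauchy_product_sums[OF n1 n2])
    moreover have "(\<Sum>j. log_moment (2 * j) 1 * z ^ j) * (\<Sum>n. \<alpha> n * z ^ n) = d 0"
    proof -
      have "sin (pi * y) > 0" using y by (intro sin_gt_zero) auto
      then show ?thesis using y unfolding sums_unique[OF 1, symmetric] sums_unique[OF 2, symmetric] d0 by simp
    qed
    moreover have "(\<Sum>j\<le>p. log_moment (2 * j) 1 * z ^ j * (\<alpha> (p - j) * z ^ (p - j))) = d p * z ^ p" for p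
      unfolding d_def sum_distrib_right
      by (intro sum.cong refl) (simp add: mult_ac flip: power_add)
    ultimately show "(\<lambda>p. d p * z ^ p) sums d 0" by simp
  qed
  then show ?thesis using d0 by (auto simp: d_def)
qed

text \<open>
  Up to the signs, the recurrences of the moments and of the arctangent coefficients coincide: each
  relates \<open>n\<close> and \<open>n + 2\<close> with index \<open>q\<close> to \<open>n + 1\<close> with index \<open>q - 1\<close>. They couple the parity of
  \<open>n\<close> to that of the index, so both parities have to be carried along.
\<close>

lemma even_odd_convolutions:
  "2 * (\<Sum>j\<le>p. \<alpha> (p - j) * log_moment (2 * j) (2 * n + 1)) = (- 1) ^ (n + p) * arctan_coeff (2 * p + 1) (2 * n + 1) \<and>
   2 * (\<Sum>j\<le>p. \<alpha> (p - j) * log_moment (2 * j + 1) (2 * n + 2)) = (- 1) ^ (n + p) * arctan_coeff (2 * p + 2) (2 * n + 2)"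
proof (induction n arbitrary: p)
  case 0
  have "log_moment (2 * j + 1) 2 = log_moment (2 * j) 1" for j
    using log_moment_rec[of 0 "2 * j + 1"] by (simp add: numeral_2_eq_2)
  moreover have "arctan_coeff (2 * p) 0 = (if p = 0 then 1 else 0)" by (cases p) auto
  moreover have "arctan_coeff (2 * p + 2) 2 = arctan_coeff (2 * p + 1) 1"
    by (simp add: numeral_2_eq_2)
  ultimately show ?case using alpha_log_moment_convolution[of p] by (auto simp: numeral_2_eq_2)
next
  case (Suc n)
  define xe where "xe p n = (\<Sum>j\<le>p. \<alpha> (p - j) * log_moment (2 * j) n)" for p n
  define xo where "xo p n = (\<Sum>j\<le>p. \<alpha> (p - j) * log_moment (2 * j + 1) n)" for p n
  have scale: "d * (c * x) = a * (c * y) + 2 * (c * z)" if "d * x = a * y + 2 * z" for a c d x y z :: real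
    using that by algebra
  have IH1: "2 * xe p (2 * n + 1) = (- 1) ^ (n + p) * arctan_coeff (2 * p + 1) (2 * n + 1)"
    and IH2: "2 * xo p (2 * n + 2) = (- 1) ^ (n + p) * arctan_coeff (2 * p + 2) (2 * n + 2)" for p
    using Suc by (simp_all add: xe_def xo_def)
  have xe_rec: "real (2 * n + 3) * xe p (2 * n + 3) =
      real (2 * n + 1) * xe p (2 * n + 1) + 2 * (if p = 0 then 0 else xo (p - 1) (2 * n + 2))" for p
  proof -
    have "real (2 * n + 3) * log_moment q (2 * n + 3) = real (2 * n + 1) * log_moment q (2 * n + 1)
        + 2 * (if q = 0 then 0 else log_moment (q - 1) (2 * n + 2))" for q
      using log_moment_rec[of "2 * n + 1" q] by (simp add: eval_nat_numeral)
    then have "real (2 * n + 3) * xe p (2 * n + 3) = (\<Sum>j\<le>p. \<alpha> (p - j) * (real (2 * n + 1) * log_moment (2 * j) (2 * n + 1)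
        + 2 * (if j = 0 then 0 else log_moment (2 * j - 1) (2 * n + 2))))"
      unfolding xe_def sum_distrib_left by (intro sum.cong refl) (simp only: mult.left_commute, simp)
    also have "\<dots> = real (2 * n + 1) * xe p (2 * n + 1)
        + 2 * (\<Sum>j\<le>p. \<alpha> (p - j) * (if j = 0 then 0 else log_moment (2 * j - 1) (2 * n + 2)))"
      unfolding xe_def sum_distrib_left sum.distrib[symmetric] by (intro sum.cong refl) (simp add: algebra_simps)
    also have "(\<Sum>j\<le>p. \<alpha> (p - j) * (if j = 0 then 0 else log_moment (2 * j - 1) (2 * n + 2))) =
        (if p = 0 then 0 else xo (p - 1) (2 * n + 2))"
      by (cases p) (simp_all add: sum.atMost_Suc_shift xo_def del: sum.atMost_Suc)
    finally show ?thesis .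
  qed
  have 1: "2 * xe p (2 * n + 3) = (- 1) ^ (Suc n + p) * arctan_coeff (2 * p + 1) (2 * n + 3)" for p
  proof -
    have c: "real (2 * n + 3) * arctan_coeff (2 * p + 1) (2 * n + 3) =
        2 * arctan_coeff (2 * p) (2 * n + 2) - real (2 * n + 1) * arctan_coeff (2 * p + 1) (2 * n + 1)"
      using arctan_coeff.simps(4)[of "2 * p" "2 * n + 1"] by (simp add: eval_nat_numeral)
    have o: "2 * (if p = 0 then 0 else xo (p - 1) (2 * n + 2)) = - ((- 1) ^ (n + p)) * arctan_coeff (2 * p) (2 * n + 2)"
      using IH2[of "p - 1"] by (cases p) auto
    have "real (2 * n + 3) * (2 * xe p (2 * n + 3)) =
        real (2 * n + 1) * (2 * xe p (2 * n + 1)) + 2 * (2 * (if p = 0 then 0 else xo (p - 1) (2 * n + 2)))"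
      by (rule scale[OF xe_rec])
    also have "\<dots> = - ((- 1) ^ (n + p)) * (2 * arctan_coeff (2 * p) (2 * n + 2) - real (2 * n + 1) * arctan_coeff (2 * p + 1) (2 * n + 1))"
      unfolding IH1 o by (simp add: algebra_simps del: arctan_coeff.simps)
    finally have "real (2 * n + 3) * (2 * xe p (2 * n + 3)) = real (2 * n + 3) * ((- 1) ^ (Suc n + p) * arctan_coeff (2 * p + 1) (2 * n + 3))"
      unfolding c[symmetric] by simp
    then show ?thesis by (simp only: mult_cancel_left) simp
  qed
  have xo_rec: "real (2 * n + 4) * xo p (2 * n + 4) = real (2 * n + 2) * xo p (2 * n + 2) + 2 * xe p (2 * n + 3)" for p
  proof -
    have "real (2 * n + 4) * log_moment (2 * j + 1) (2 * n + 4) = real (2 * n + 2) * log_moment (2 * j + 1) (2 * n + 2)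
        + 2 * log_moment (2 * j) (2 * n + 3)" for j
      using log_moment_rec[of "2 * n + 2" "2 * j + 1"] by (simp add: eval_nat_numeral)
    then show ?thesis
      unfolding xo_def xe_def sum_distrib_left sum.distrib[symmetric]
      by (intro sum.cong refl scale)
  qed
  have 2: "2 * xo p (2 * n + 4) = (- 1) ^ (Suc n + p) * arctan_coeff (2 * p + 2) (2 * n + 4)" for p
  proof -
    have c: "real (2 * n + 4) * arctan_coeff (2 * p + 2) (2 * n + 4) =
        2 * arctan_coeff (2 * p + 1) (2 * n + 3) - real (2 * n + 2) * arctan_coeff (2 * p + 2) (2 * n + 2)"
      using arctan_coeff.simps(4)[of "2 * p + 1" "2 * n + 2"] by (simp add: eval_nat_numeral)
    have "real (2 * n + 4) * (2 * xo p (2 * n + 4)) = real (2 * n + 2) * (2 * xo p (2 * n + 2)) + 2 * (2 * xe p (2 * n + 3))"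
      by (rule scale[OF xo_rec])
    also have "\<dots> = (- 1) ^ (Suc n + p) * (2 * arctan_coeff (2 * p + 1) (2 * n + 3) - real (2 * n + 2) * arctan_coeff (2 * p + 2) (2 * n + 2))"
      unfolding IH2 1 by (simp add: algebra_simps del: arctan_coeff.simps)
    finally have "real (2 * n + 4) * (2 * xo p (2 * n + 4)) = real (2 * n + 4) * ((- 1) ^ (Suc n + p) * arctan_coeff (2 * p + 2) (2 * n + 4))"
      unfolding c[symmetric] by (simp only: mult_ac)
    then show ?thesis by (simp only: mult_cancel_left) simp
  qed
  have "2 * Suc n + 1 = 2 * n + 3" "2 * Suc n + 2 = 2 * n + 4" by auto
  then show ?case using 1 2 by (simp only: xe_def xo_def)
qed

section \<open>Integral formula and symmetry\<close>

text \<open>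
  Each integration against \<open>dt / t\<close> divides the moment of order \<open>n\<close> by \<open>n\<close>, by parts.
\<close>

lemma chain_moment:
  assumes "i \<le> l" and n: "n \<ge> 1"
  shows "((\<lambda>t. chain l i q t * t ^ (n - 1)) has_integral (log_moment q n / real n ^ i)) {0..1}"
  using assms(1)
proof (induction i)
  case 0
  then show ?case using has_integral_log_moment[of q n] by (simp add: chain_0[abs_def])
next
  case (Suc i)
  let ?f' = "\<lambda>t. real n * (chain l (Suc i) q t * t ^ (n - 1)) - chain l i q t * t ^ (n - 1)"
  have IH: "((\<lambda>t. chain l i q t * t ^ (n - 1)) has_integral (log_moment q n / real n ^ i)) {0..1}"
    using Suc by simp
  have "(?f' has_integral (0 - 0)) {0..1}"
  proof (rule has_integral_from_limits)
    fix t :: real assume t: "0 < t" "t < 1"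
    have "((\<lambda>t. chain l (Suc i) q t * t ^ n) has_real_derivative
        (chain_kernel l i t * chain l i q t * t ^ n + (real n * t ^ (n - Suc 0)) * chain l (Suc i) q t)) (at t)"
      by (rule DERIV_mult[OF chain_deriv[OF t] DERIV_pow])
    moreover have "chain_kernel l i t * chain l i q t * t ^ n = - (chain l i q t * t ^ (n - 1))"
      using Suc.prems t n by (cases n) (auto simp: chain_kernel_def)
    ultimately show "((\<lambda>t. chain l (Suc i) q t * t ^ n) has_real_derivative ?f' t) (at t)"
      by (simp add: algebra_simps)
  next
    have "((\<lambda>t. t * chain l (Suc i) q t * t ^ (n - 1)) \<longlongrightarrow> 0 * 0 ^ (n - 1)) (at_right 0)"
      by (intro tendsto_intros chain_times_id_tendsto)
    then show "((\<lambda>t. chain l (Suc i) q t * t ^ n) \<longlongrightarrow> 0) (at_right 0)"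
      using n by (cases n) (auto simp: mult_ac)
    have "((\<lambda>t. chain l (Suc i) q t * t ^ n) \<longlongrightarrow> 0 * 1 ^ n) (at_left 1)"
      by (intro tendsto_intros chain_tendsto_at_left_1)
    then show "((\<lambda>t. chain l (Suc i) q t * t ^ n) \<longlongrightarrow> 0) (at_left 1)" by simp
  qed auto
  from has_integral_add[OF this IH]
  have "((\<lambda>t. real n * (chain l (Suc i) q t * t ^ (n - 1))) has_integral (log_moment q n / real n ^ i)) {0..1}"
    by simp
  from has_integral_divide[OF this, of "real n"] show ?case using n by (simp add: mult.commute)
qed

lemma abs_chain_integrable: "(\<lambda>t. \<bar>chain l l q t\<bar> * t) integrable_on {0..1}"
proof (rule has_integral_integrable)
  show "((\<lambda>t. \<bar>chain l l q t\<bar> * t) has_integral (log_moment q 2 / 2 ^ l)) {0..1}"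
    by (rule has_integral_spike_finite[OF _ _ chain_moment[of l l 2 q, simplified], of "{0, 1}"])
      (use chain_nonneg[of l l] in auto)
qed

lemma abs_arctan_power_le: "\<bar>arctan_power i t\<bar> \<le> (2 * \<bar>t\<bar>) ^ i"
proof -
  have "\<bar>arctan_power i t\<bar> = (2 * \<bar>arctan t\<bar>) ^ i / fact i"
    by (simp add: arctan_power_def power_abs abs_mult)
  also have "\<dots> \<le> (2 * \<bar>arctan t\<bar>) ^ i / 1"
    by (intro divide_left_mono) (auto simp: fact_ge_1)
  also have "\<dots> \<le> (2 * \<bar>t\<bar>) ^ i"
    using abs_arctan_le by (auto intro!: power_mono)
  finally show ?thesis .
qed

text \<open>
  Repeated integration by parts, done at once: the derivative of the alternating sum \<open>H\<close> of
  products of a chain with an arctangent power telescopes, leaving only the product of the chain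
  of length \<open>l\<close> with the highest arctangent power. At \<open>t = 0\<close> only the term without an
  arctangent factor survives, and its limit is \<open>W\<close> by Abel's theorem.
\<close>

lemma W_integral:
  assumes M: "M \<ge> 1"
  shows "((\<lambda>t. chain l l q t * (2 / (1 + t ^ 2) * arctan_power (M - 1) t)) has_integral
    ((- 1) ^ M * W l (q + (l + M)) (l + M))) {0..1}"
proof -
  define \<kappa> where "\<kappa> t = 2 / (1 + t ^ 2)" for t :: real
  define H where "H t = (\<Sum>i<M. (- 1) ^ i * (chain l (l + M - i) q t * arctan_power i t))" for t
  \<comment> \<open>The two parts of the derivative of the \<open>i\<close>-th summand of \<open>H\<close> are, up to the factor \<open>\<kappa> t\<close>, \<open>J i\<close> and \<open>- J (i + 1)\<close>;
      \<open>J 0 = 0\<close>, the derivative of the constant zeroth arctangent power.\<close>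
  define J where "J i t = (- 1) ^ i * (chain l (l + M - i) q t * (if i = 0 then 0 else arctan_power (i - 1) t))" for i t
  have "((\<lambda>t. \<kappa> t * (J 0 t - J M t)) has_integral (0 - W l (q + (l + M)) (l + M))) {0..1}"
  proof (rule has_integral_from_limits)
    fix t :: real assume t: "0 < t" "t < 1"
    have "((\<lambda>t. (- 1) ^ i * (chain l (l + M - i) q t * arctan_power i t)) has_real_derivative
        \<kappa> t * (J i t - J (Suc i) t)) (at t)" if i: "i < M" for i
    proof -
      have "\<not> l + M - Suc i < l" using i by simp
      then have "chain_kernel l (l + M - Suc i) t = \<kappa> t" by (simp add: chain_kernel_def \<kappa>_def)
      then have c: "(chain l (l + M - i) q has_real_derivative (\<kappa> t * chain l (l + M - Suc i) q t)) (at t)"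
        using chain_deriv[OF t, of l "l + M - Suc i" q] i by (simp add: Suc_diff_Suc)
      have a: "(arctan_power i has_real_derivative (\<kappa> t * (if i = 0 then 0 else arctan_power (i - 1) t))) (at t)"
        using arctan_power_deriv[of "i - 1" t]
        by (cases i) (auto simp: \<kappa>_def arctan_power_def[of 0, abs_def])
      have "((\<lambda>t. (- 1) ^ i * (chain l (l + M - i) q t * arctan_power i t)) has_real_derivative
        (- 1) ^ i * ((\<kappa> t * chain l (l + M - Suc i) q t) * arctan_power i t
           + (\<kappa> t * (if i = 0 then 0 else arctan_power (i - 1) t)) * chain l (l + M - i) q t)) (at t)"
        by (rule DERIV_cmult[OF DERIV_mult[OF c a]])
      moreover have "(- 1) ^ i * ((\<kappa> t * chain l (l + M - Suc i) q t) * arctan_power i t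
           + (\<kappa> t * (if i = 0 then 0 else arctan_power (i - 1) t)) * chain l (l + M - i) q t) = \<kappa> t * (J i t - J (Suc i) t)"
        by (simp add: J_def algebra_simps)
      ultimately show ?thesis by (simp only:)
    qed
    then have "(H has_real_derivative (\<Sum>i<M. \<kappa> t * (J i t - J (Suc i) t))) (at t)"
      unfolding H_def[abs_def] by (intro DERIV_sum) auto
    moreover have "(\<Sum>i<M. \<kappa> t * (J i t - J (Suc i) t)) = \<kappa> t * (J 0 t - J M t)"
      by (simp only: sum_distrib_left[symmetric] sum_lessThan_telescope'[of "\<lambda>i. J i t"])
    ultimately show "(H has_real_derivative \<kappa> t * (J 0 t - J M t)) (at t)"
      by (simp only:)
  next
    have "((\<lambda>t. (- 1) ^ i * (chain l (l + M - i) q t * arctan_power i t)) \<longlongrightarrow>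
        (if i = 0 then W l (q + (l + M)) (l + M) else 0)) (at_right 0)" if i: "i < M" for i
    proof (cases i)
      case 0
      then show ?thesis
        using chain_tendsto_W[of l "l + M" q] M by (simp add: arctan_power_def)
    next
      case (Suc j)
      have "((\<lambda>t. chain l (l + M - i) q t * arctan_power i t) \<longlongrightarrow> 0) (at_right 0)"
      proof (rule Lim_null_comparison)
        show "((\<lambda>t. 2 ^ i * \<bar>t * chain l (l + M - i) q t\<bar>) \<longlongrightarrow> 0) (at_right 0)"
          using tendsto_mult_right_zero[OF tendsto_rabs_zero[OF chain_times_id_tendsto]] by auto
        show "eventually (\<lambda>t. norm (chain l (l + M - i) q t * arctan_power i t) \<le> 2 ^ i * \<bar>t * chain l (l + M - i) q t\<bar>) (at_right 0)"
        proof (rule eventually_at_right_0_unit)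
          fix t :: real assume t: "0 < t" "t < 1"
          have "\<bar>arctan_power i t\<bar> \<le> 2 ^ i * t ^ i"
            using abs_arctan_power_le[of i t] t by (simp add: power_mult_distrib)
          also have "\<dots> \<le> 2 ^ i * t"
            using t Suc by (auto intro!: mult_left_mono mult_left_le power_le_one)
          finally show "norm (chain l (l + M - i) q t * arctan_power i t) \<le> 2 ^ i * \<bar>t * chain l (l + M - i) q t\<bar>"
            using t mult_left_mono[of "\<bar>arctan_power i t\<bar>" "2 ^ i * t" "\<bar>chain l (l + M - i) q t\<bar>"]
            by (simp add: abs_mult mult_ac)
        qed
      qed
      then have "((\<lambda>t. (- 1) ^ i * (chain l (l + M - i) q t * arctan_power i t)) \<longlongrightarrow> 0) (at_right 0)"
        by (rule tendsto_mult_right_zero)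
      then show ?thesis using Suc by simp
    qed
    then have "(H \<longlongrightarrow> (\<Sum>i<M. if i = 0 then W l (q + (l + M)) (l + M) else 0)) (at_right 0)"
      unfolding H_def[abs_def] by (intro tendsto_sum) auto
    then show "(H \<longlongrightarrow> W l (q + (l + M)) (l + M)) (at_right 0)"
      using M by (simp add: sum.delta)
  next
    have "((\<lambda>t. (- 1) ^ i * (chain l (l + M - i) q t * arctan_power i t)) \<longlongrightarrow> 0) (at_left 1)" if i: "i < M" for i
    proof -
      have "(chain l (Suc (l + M - Suc i)) q \<longlongrightarrow> 0) (at_left 1)" by (rule chain_tendsto_at_left_1)
      moreover have "Suc (l + M - Suc i) = l + M - i" using i by simp
      ultimately have "((\<lambda>t. (- 1) ^ i * (chain l (l + M - i) q t * arctan_power i t)) \<longlongrightarrow>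
          (- 1) ^ i * (0 * arctan_power i 1)) (at_left 1)"
        unfolding arctan_power_def by (intro tendsto_intros) auto
      then show ?thesis by simp
    qed
    then have "(H \<longlongrightarrow> (\<Sum>i<M. 0)) (at_left 1)"
      unfolding H_def[abs_def] by (intro tendsto_sum) auto
    then show "(H \<longlongrightarrow> 0) (at_left 1)" by simp
  qed auto
  from has_integral_mult_right[OF this, of "(- 1) ^ Suc M"]
  have "((\<lambda>t. (- 1) ^ Suc M * (\<kappa> t * (J 0 t - J M t))) has_integral (- 1) ^ Suc M * (0 - W l (q + (l + M)) (l + M))) {0..1}" .
  moreover have "(- 1) ^ Suc M * (\<kappa> t * (J 0 t - J M t)) = chain l l q t * (2 / (1 + t ^ 2) * arctan_power (M - 1) t)" for t
  proof -
    have "(- 1 :: real) ^ M * (- 1) ^ M = 1" by (simp flip: power_mult_distrib)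
    then show ?thesis using M by (simp add: J_def \<kappa>_def)
  qed
  ultimately show ?thesis by simp
qed

text \<open>
  For \<open>s < 1\<close> the coefficients \<open>n b\<^sub>n s\<^sup>n\<close> are absolutely summable. As \<open>b\<^sub>0\<close> and \<open>b\<^sub>1\<close> drop out, all partial
  sums are dominated by a multiple of \<open>t\<close> times the chain, which is integrable.
\<close>

lemma twisted_integral_sums:
  fixes s :: real and l q M :: nat
  assumes M: "M \<ge> 2" "even M" and s: "0 < s" "s < 1"
  defines "g \<equiv> \<lambda>t. chain l l q t * (s * (2 / (1 + (s * t) ^ 2) * arctan_power (M - 1) (s * t)))"
  shows "g integrable_on {0..1}"
    and "(\<lambda>n. real n * arctan_coeff M n * s ^ n * (log_moment q n / real n ^ l)) sums integral {0..1} g"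
proof -
  define c where "c n = real n * arctan_coeff M n * s ^ n" for n
  have c01: "c n = 0" if "n < 2" for n
  proof -
    have "n = 0 \<or> odd n" using that by (auto simp: less_2_cases_iff)
    then show ?thesis using arctan_coeff_parity[of M n] M(2) by (auto simp: c_def)
  qed
  define f where "f N t = (\<Sum>n<N. c n * (chain l l q t * t ^ (n - 1)))" for N t
  have f: "(f N has_integral (\<Sum>n<N. c n * (log_moment q n / real n ^ l))) {0..1}" for N
    unfolding f_def[abs_def]
  proof (intro has_integral_sum)
    fix n
    show "((\<lambda>t. c n * (chain l l q t * t ^ (n - 1))) has_integral c n * (log_moment q n / real n ^ l)) {0..1}"
    proof (cases "n = 0")
      case False
      then show ?thesis by (intro has_integral_mult_right chain_moment) auto
    qed (simp add: c_def)
  qed auto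
  have diffs: "(\<lambda>n. diffs (arctan_coeff M) n * z ^ n) sums (2 / (1 + z ^ 2) * arctan_power (M - 1) z)"
    if z: "\<bar>z\<bar> < 1" for z
    using arctan_power_deriv[of "M - 1" z] M(1) z arctan_power_sums
    by (intro termdiffs_sums_strong[where K = 1 and f = "arctan_power M"]) auto
  have abs_c: "summable (\<lambda>n. \<bar>c n\<bar>)"
  proof -
    \<comment> \<open>a point of convergence beyond \<open>s\<close>\<close>
    define s' where "s' = (1 + s) / 2"
    have "summable (\<lambda>n. norm (diffs (arctan_coeff M) n * s ^ n))"
      by (rule powser_insidea[OF sums_summable[OF diffs[of s']]]) (use s in \<open>auto simp: s'_def\<close>)
    then have "summable (\<lambda>n. s * norm (diffs (arctan_coeff M) n * s ^ n))" by (rule summable_mult)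
    moreover have "s * norm (diffs (arctan_coeff M) n * s ^ n) = \<bar>c (Suc n)\<bar>" for n
      using s by (simp add: diffs_def c_def abs_mult)
    ultimately have "summable (\<lambda>n. \<bar>c (Suc n)\<bar>)" by (simp only:)
    then show ?thesis by (simp only: summable_Suc_iff[of "\<lambda>n. \<bar>c n\<bar>"])
  qed
  define C where "C = (\<Sum>n. \<bar>c n\<bar>)"
  have h: "(\<lambda>t. C * (\<bar>chain l l q t\<bar> * t)) integrable_on {0..1}" by (intro integrable_on_mult_right abs_chain_integrable)
  have bound: "norm (f N t) \<le> C * (\<bar>chain l l q t\<bar> * t)" if t: "t \<in> {0..1}" for N t
  proof -
    have "norm (f N t) \<le> (\<Sum>n<N. \<bar>c n\<bar> * (\<bar>chain l l q t\<bar> * t))"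
      unfolding f_def
    proof (rule sum_norm_le)
      fix n
      show "norm (c n * (chain l l q t * t ^ (n - 1))) \<le> \<bar>c n\<bar> * (\<bar>chain l l q t\<bar> * t)"
      proof (cases "n < 2")
        case False
        then obtain k where k: "n - 1 = Suc k" using that[of "n - 2"] by simp
        have "t ^ (n - 1) \<le> t" unfolding k using t by (auto intro!: mult_left_le power_le_one)
        then show ?thesis using t by (auto simp: abs_mult power_abs intro!: mult_left_mono)
      qed (simp add: c01)
    qed
    also have "\<dots> = (\<Sum>n<N. \<bar>c n\<bar>) * (\<bar>chain l l q t\<bar> * t)" by (simp add: sum_distrib_right)
    also have "\<dots> \<le> C * (\<bar>chain l l q t\<bar> * t)"
      unfolding C_def using t abs_c by (intro mult_right_mono sum_le_suminf) auto
    finally show ?thesis .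
  qed
  have lim: "(\<lambda>N. f N t) \<longlonglongrightarrow> g t" if t: "t \<in> {0..1}" for t
  proof -
    have st: "\<bar>s * t\<bar> < 1"
    proof -
      have "s * t \<le> s * 1" using s t by (intro mult_left_mono) auto
      moreover have "0 \<le> s * t" using s t by simp
      ultimately show ?thesis using s by (subst abs_of_nonneg) linarith+
    qed
    have "(\<lambda>n. chain l l q t * (s * (diffs (arctan_coeff M) n * (s * t) ^ n))) sums g t"
      unfolding g_def by (intro sums_mult diffs st)
    moreover have "chain l l q t * (s * (diffs (arctan_coeff M) n * (s * t) ^ n)) =
        c (Suc n) * (chain l l q t * t ^ (Suc n - 1))" for n
      by (simp add: diffs_def c_def power_mult_distrib)
    ultimately have "(\<lambda>n. c (Suc n) * (chain l l q t * t ^ (Suc n - 1))) sums g t" by simp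
    then have "(\<lambda>n. c n * (chain l l q t * t ^ (n - 1))) sums g t"
      by (subst (asm) sums_Suc_iff) (simp add: c01)
    then show ?thesis by (simp add: sums_def f_def)
  qed
  show "g integrable_on {0..1}"
    by (rule dominated_convergence(1)[OF has_integral_integrable[OF f] h bound lim])
  have "(\<lambda>N. integral {0..1} (f N)) \<longlonglongrightarrow> integral {0..1} g"
    by (rule dominated_convergence(2)[OF has_integral_integrable[OF f] h bound lim])
  then show "(\<lambda>n. real n * arctan_coeff M n * s ^ n * (log_moment q n / real n ^ l)) sums integral {0..1} g"
    by (simp only: integral_unique[OF f] sums_def c_def)
qed

lemma twisted_integral_tendsto:
  assumes M: "M \<ge> 2" "even M" and s: "\<And>k. 0 < s k" "\<And>k. s k < 1" and lim: "s \<longlonglongrightarrow> 1"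
  shows "(\<lambda>k. integral {0..1} (\<lambda>t. chain l l q t * (s k * (2 / (1 + (s k * t) ^ 2) * arctan_power (M - 1) (s k * t)))))
    \<longlonglongrightarrow> W l (q + (l + M)) (l + M)"
proof -
  have h: "(\<lambda>t. 2 ^ M * (\<bar>chain l l q t\<bar> * t)) integrable_on {0..1}" by (intro integrable_on_mult_right abs_chain_integrable)
  have "(\<lambda>k. integral {0..1} (\<lambda>t. chain l l q t * (s k * (2 / (1 + (s k * t) ^ 2) * arctan_power (M - 1) (s k * t)))))
    \<longlonglongrightarrow> integral {0..1} (\<lambda>t. chain l l q t * (2 / (1 + t ^ 2) * arctan_power (M - 1) t))"
  proof (rule dominated_convergence(2)[OF _ h])
    fix k
    show "(\<lambda>t. chain l l q t * (s k * (2 / (1 + (s k * t) ^ 2) * arctan_power (M - 1) (s k * t)))) integrable_on {0..1}"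
      by (rule twisted_integral_sums(1)[OF M s])
  next
    fix k and t :: real assume t: "t \<in> {0..1}"
    obtain j where j: "M - 1 = Suc j" "M = Suc (Suc j)" using M(1) that[of "M - 2"] by simp
    have st: "0 \<le> s k * t" "s k * t \<le> t" "s k * t \<le> 1"
      using t s[of k] mult_right_mono[of "s k" 1 t] by auto
    have "\<bar>arctan_power (M - 1) (s k * t)\<bar> \<le> (2 * (s k * t)) ^ (M - 1)"
      using abs_arctan_power_le[of "M - 1" "s k * t"] st by simp
    also have "\<dots> = 2 ^ (M - 1) * ((s k * t) * (s k * t) ^ j)" unfolding j by (simp add: power_mult_distrib)
    also have "\<dots> \<le> 2 ^ (M - 1) * (t * 1)"
      using st t by (intro mult_left_mono mult_mono power_le_one) auto
    finally have a: "\<bar>arctan_power (M - 1) (s k * t)\<bar> \<le> 2 ^ (M - 1) * t" by simp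
    have "2 / (1 + (s k * t) ^ 2) \<le> 2 / 1"
      by (intro divide_left_mono) (auto simp: add_pos_nonneg)
    then have b: "2 / (1 + (s k * t) ^ 2) \<le> 2" by simp
    have "\<bar>s k * (2 / (1 + (s k * t) ^ 2) * arctan_power (M - 1) (s k * t))\<bar> =
        s k * (2 / (1 + (s k * t) ^ 2) * \<bar>arctan_power (M - 1) (s k * t)\<bar>)"
      using s(1)[of k] by (simp add: abs_mult)
    also have "\<dots> \<le> 1 * (2 * (2 ^ (M - 1) * t))"
      using s[of k] a b by (intro mult_mono) auto
    also have "\<dots> = 2 ^ M * t" unfolding j by simp
    finally have "\<bar>chain l l q t\<bar> * \<bar>s k * (2 / (1 + (s k * t) ^ 2) * arctan_power (M - 1) (s k * t))\<bar>
        \<le> \<bar>chain l l q t\<bar> * (2 ^ M * t)"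
      by (intro mult_left_mono) auto
    then show "norm (chain l l q t * (s k * (2 / (1 + (s k * t) ^ 2) * arctan_power (M - 1) (s k * t))))
        \<le> 2 ^ M * (\<bar>chain l l q t\<bar> * t)"
      by (simp only: real_norm_def abs_mult[of "chain l l q t"] mult.left_commute[of "2 ^ M"])
  next
    fix t :: real
    have n: "1 + t ^ 2 \<noteq> 0" by (metis add_pos_nonneg less_irrefl zero_le_power2 zero_less_one)
    have "(\<lambda>k. chain l l q t * (s k * (2 / (1 + (s k * t) ^ 2) * arctan_power (M - 1) (s k * t))))
        \<longlonglongrightarrow> chain l l q t * (1 * (2 / (1 + (1 * t) ^ 2) * arctan_power (M - 1) (1 * t)))"
      unfolding arctan_power_def by (intro tendsto_intros lim) (use n in auto)
    then show "(\<lambda>k. chain l l q t * (s k * (2 / (1 + (s k * t) ^ 2) * arctan_power (M - 1) (s k * t))))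
        \<longlonglongrightarrow> chain l l q t * (2 / (1 + t ^ 2) * arctan_power (M - 1) t)" by simp
  qed
  also have "integral {0..1} (\<lambda>t. chain l l q t * (2 / (1 + t ^ 2) * arctan_power (M - 1) t)) = W l (q + (l + M)) (l + M)"
    using integral_unique[OF W_integral[of M l q]] M by simp
  finally show ?thesis .
qed

text \<open>
  After the convolution both arctangent coefficients appear on an equal footing; the odd \<open>n\<close> drop
  out by parity.
\<close>

lemma odd_convolution_symmetric:
  assumes "m \<ge> 1" "p \<ge> 1"
  shows "(- 1) ^ m * (real n * arctan_coeff (2 * m) n * (\<Sum>j = 1..p. \<alpha> (p - j) * log_moment (2 * j - 1) n)) =
    (- 1) ^ p * (real n * arctan_coeff (2 * p) n * (\<Sum>j = 1..m. \<alpha> (m - j) * log_moment (2 * j - 1) n))"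
proof (cases "odd n \<or> n = 0")
  case True
  then show ?thesis using arctan_coeff_parity[of "2 * m" n] arctan_coeff_parity[of "2 * p" n] by auto
next
  case False
  then obtain i where "n = 2 * i" "i \<noteq> 0" by (auto elim: evenE)
  then obtain k where k: "n = 2 * k + 2" by (cases i) auto
  have conv: "(\<Sum>j = 1..p. \<alpha> (p - j) * log_moment (2 * j - 1) n) = (- 1) ^ (k + p + 1) * arctan_coeff (2 * p) n / 2"
    if pos: "p \<ge> 1" for p
  proof -
    obtain r where r: "p = Suc r" using pos by (cases p) auto
    have "(\<Sum>j = 1..p. \<alpha> (p - j) * log_moment (2 * j - 1) n) = (\<Sum>j\<le>r. \<alpha> (r - j) * log_moment (2 * j + 1) n)"
      unfolding r One_nat_def sum.shift_bounds_cl_Suc_ivl atLeast0AtMost by simp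
    then show ?thesis
      using conjunct2[OF even_odd_convolutions[of r k]] by (simp add: r k del: arctan_coeff.simps)
  qed
  have sq: "(- 1 :: real) ^ x * (- 1) ^ x = 1" for x by (simp flip: power_mult_distrib)
  show ?thesis unfolding conv[OF assms(1)] conv[OF assms(2)] by (simp add: power_add)
qed

theorem theorem1p2p1:
  fixes m p l :: nat
  assumes "m \<ge> 1" and "p \<ge> 1"
  shows "(- 1) ^ m * (\<Sum>j = 1..p. \<alpha> (p - j) * W l (2 * j + 2 * m + l - 1) (2 * m + l))
       = (- 1) ^ p * (\<Sum>j = 1..m. \<alpha> (m - j) * W l (2 * j + 2 * p + l - 1) (2 * p + l))"
proof -
  define R where "R m q s = integral {0..1} (\<lambda>t. chain l l q t *
     (s * (2 / (1 + (s * t) ^ 2) * arctan_power (2 * m - 1) (s * t))))" for m q and s :: real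
  define s where "s k = 1 - 1 / (real k + 2)" for k
  have s: "0 < s k" "s k < 1" for k by (auto simp: s_def field_simps)
  have s_lim: "s \<longlonglongrightarrow> 1"
  proof -
    have "(\<lambda>k. 1 / real (k + 2)) \<longlonglongrightarrow> 0" by (rule LIMSEQ_ignore_initial_segment[OF lim_1_over_n])
    from tendsto_diff[OF tendsto_const[of 1] this] show ?thesis by (simp add: s_def[abs_def] add.commute)
  qed
  have R_lim: "(\<lambda>k. (- 1) ^ m * (\<Sum>j = 1..p. \<alpha> (p - j) * R m (2 * j - 1) (s k))) \<longlonglongrightarrow>
     (- 1) ^ m * (\<Sum>j = 1..p. \<alpha> (p - j) * W l (2 * j + 2 * m + l - 1) (2 * m + l))" if "m \<ge> 1" for m p
  proof (intro tendsto_intros)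
    fix j assume j: "j \<in> {1..p}"
    have weight: "2 * j - 1 + (l + 2 * m) = 2 * j + 2 * m + l - 1" using j by auto
    have depth: "l + 2 * m = 2 * m + l" by simp
    show "(\<lambda>k. R m (2 * j - 1) (s k)) \<longlonglongrightarrow> W l (2 * j + 2 * m + l - 1) (2 * m + l)"
      unfolding R_def
      by (rule twisted_integral_tendsto[of "2 * m" s l "2 * j - 1", unfolded weight, unfolded depth])
        (use that s s_lim in auto)
  qed
  have R_sums: "(\<lambda>n. ((- 1) ^ m * (real n * arctan_coeff (2 * m) n * (\<Sum>j = 1..p. \<alpha> (p - j) * log_moment (2 * j - 1) n)))
        * (s k ^ n / real n ^ l)) sums
      ((- 1) ^ m * (\<Sum>j = 1..p. \<alpha> (p - j) * R m (2 * j - 1) (s k)))" if "m \<ge> 1" for m p k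
  proof -
    have "(\<lambda>n. (- 1) ^ m * (\<Sum>j = 1..p. \<alpha> (p - j) *
        (real n * arctan_coeff (2 * m) n * s k ^ n * (log_moment (2 * j - 1) n / real n ^ l)))) sums
      ((- 1) ^ m * (\<Sum>j = 1..p. \<alpha> (p - j) * R m (2 * j - 1) (s k)))"
      unfolding R_def using that s by (intro sums_mult sums_sum twisted_integral_sums(2)) auto
    moreover have "(- 1) ^ m * (\<Sum>j = 1..p. \<alpha> (p - j) *
        (real n * arctan_coeff (2 * m) n * s k ^ n * (log_moment (2 * j - 1) n / real n ^ l))) =
      ((- 1) ^ m * (real n * arctan_coeff (2 * m) n * (\<Sum>j = 1..p. \<alpha> (p - j) * log_moment (2 * j - 1) n)))
        * (s k ^ n / real n ^ l)" for n
      unfolding sum_distrib_left sum_distrib_right by (intro sum.cong refl) (simp add: mult_ac)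
    ultimately show ?thesis by (simp only:)
  qed
  have symmetric: "(- 1) ^ m * (\<Sum>j = 1..p. \<alpha> (p - j) * R m (2 * j - 1) (s k)) =
      (- 1) ^ p * (\<Sum>j = 1..m. \<alpha> (m - j) * R p (2 * j - 1) (s k))" for k
    using R_sums[OF assms(1), of p k] R_sums[OF assms(2), of m k]
    unfolding odd_convolution_symmetric[OF assms] by (rule sums_unique2)
  show ?thesis
    using R_lim[OF assms(1), of p] R_lim[OF assms(2), of m] unfolding symmetric by (rule LIMSEQ_unique)
qed

end
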